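(* Let $n=2r+1$ be odd ($r\ge1$) and $\ell\in\{1,r+1,n\}$; put $p=n+1$ if $\ell\in\{1,n\}$ and $p=2$ if $\ell=r+1$. Let $L\ge1$ with $p\ne2$ or $L>1$, and let $\epsilon$ be a primitive $(pL)$-th root of unity. There is an irreducible $\mathcal U_\epsilon(sl_{n+1}^{tor})'$-module $V(e^{\varpi_\ell}Y_{\ell,0}Y_{0,d_\ell}^{-1})_\epsilon$ of dimension $L\binom{n+1}{\ell}$ such that $$\chi_\epsilon\big(V(e^{\varpi_\ell}Y_{\ell,0}Y_{0,d_\ell}^{-1})_\epsilon\big)=\sum_{m\in\mathcal E_\epsilon}m.$$ Furthermore there exists a basis $(v_m)$ of it indexed by $\mathcal E_\epsilon$ on which the action is given, for $i\in I$, $r\in\mathbb Z$, $s>0$ and with $v_0=0$, by $$x_{i,r}^+\cdot v_m=\epsilon^{r(p_i(m)-1)}v_{\tilde e_i\cdot m},\qquad x_{i,r}^-\cdot v_m=\epsilon^{r(q_i(m)+1)}v_{\tilde f_i\cdot m},$$ $$\phi^\pm_{i,\pm s}\cdot v_m=\pm(\epsilon-\epsilon^{-1})\big(\varphi_i(m)\epsilon^{\pm s(q_i(m)+1)}-\varepsilon_i(m)\epsilon^{\pm s(p_i(m)-1)}\big)v_m,\qquad k_i^{\pm1}\cdot v_m=\epsilon^{\pm(\varphi_i(m)-\varepsilon_i(m))}v_m.$$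
   Context: Root data. $I=\{0,\dots,n\}$ identified with $\mathbb Z/(n+1)\mathbb Z$, $C=(C_{i,j})_{i,j\in I}$ the Cartan matrix of type $A_n^{(1)}$ ($C_{i,i}=2$, $C_{i,i\pm1}=-1$, other entries $0$), $\mathfrak h=\bigoplus_{i\in I}\mathbb Q h_i\oplus\mathbb Q d$; $\alpha_i(h_j)=C_{j,i}$, $\alpha_i(d)=\delta_{0,i}$, $\Lambda_i(h_j)=\delta_{i,j}$, $\Lambda_i(d)=0$; $\delta=\sum_i\alpha_i$, $P=\{\lambda\in\mathfrak h^*:\lambda(h_i)\in\mathbb Z\ \forall i\}$, $\varpi_\ell=\Lambda_\ell-\Lambda_0$, $d_\ell=\min(\ell,n+1-\ell)$. Monomial crystal. Consider monomials $m=e^{\omega(m)}\prod_{i\in I,l\in\mathbb Z}Y_{i,l}^{u_{i,l}(m)}$ with $u_{i,l}(m)\in\mathbb Z$ (finitely many non-zero), $\omega(m)\in P$, $\sum_l u_{i,l}(m)=\omega(m)(h_i)$. Put $A_{i,l}=e^{\alpha_i}Y_{i,l-1}Y_{i,l+1}Y_{i-1,l}^{-1}Y_{i+1,l}^{-1}$. Fix $s:I\to\{0,1\}$ with $s_i+s_j=1$ whenever $C_{i,j}=-1$ (chosen so that the monomials considered lie in $\mathcal M$); $\mathcal M$ is the group of monomials with $u_{i,l}(m)=0$ whenever $l\equiv s_i+1\bmod 2$. Set $\varphi_{i,L'}(m)=\sum_{l\le L'}u_{i,l}(m)$, $\varphi_i(m)=\max_{L'}\varphi_{i,L'}(m)$,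 $\varepsilon_{i,L'}(m)=-\sum_{l\ge L'}u_{i,l}(m)$, $\varepsilon_i(m)=\max_{L'}\varepsilon_{i,L'}(m)$, $p_i(m)=\max\{L':\varepsilon_{i,L'}(m)=\varepsilon_i(m)\}$, $q_i(m)=\min\{L':\varphi_{i,L'}(m)=\varphi_i(m)\}$; $\tilde e_i\cdot m=0$ if $\varepsilon_i(m)=0$, else $\tilde e_i\cdot m=mA_{i,p_i(m)-1}$; $\tilde f_i\cdot m=0$ if $\varphi_i(m)=0$, else $\tilde f_i\cdot m=mA_{i,q_i(m)+1}^{-1}$. $\mathcal M(m)$ is the connected subcrystal generated by $m$; $\mathcal E$ is the set of monomials of $\mathcal M(e^{\varpi_\ell}Y_{\ell,0}Y_{0,d_\ell}^{-1})$. For the $\ell$ considered, the shift $\tau_{p,-\delta}:e^\lambda\prod Y_{i,l}^{u_{i,l}}\mapsto e^{\lambda-\delta}\prod Y_{i,l+p}^{u_{i,l}}$ preserves $\mathcal E$ and commutes with the Kashiwara operators. Reduction. $\mathcal E_\epsilon$ is the image of $\mathcal E$ under the map sending $e^\nu\mapsto1$ and $Y_{i,l}^{\pm1}\mapsto Y_{i,\bar l}^{\pm1}$, $\bar l\in\mathbb Z/pL\mathbb Z$. For $m\in\mathcal E_\epsilon$ the quantities $\varepsilon_i(m),\varphi_i(m)$, $p_i(m),q_i(m)$ (modulo $pL$) and $\tilde e_i\cdot m,\tilde f_i\cdot m\in\mathcal E_\epsilon\cup\{0\}$ are those induced from any lift of $m$ to $\mathcal E$ (lifts differ by powers of $\tau_{p,-\delta}^L$).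 In the formulas, a term in which $p_i(m)$ (resp. $q_i(m)$) is undefined, i.e. $\varepsilon_i(m)=0$ (resp. $\varphi_i(m)=0$), is zero. Algebra. With $[l]_\epsilon=\frac{\epsilon^l-\epsilon^{-l}}{\epsilon-\epsilon^{-1}}$, $\mathcal U_\epsilon(sl_{n+1}^{tor})'$ (quantum toroidal algebra at $\epsilon$, without divided powers and derivation element) is the $\mathbb C$-algebra with generators $x_{i,r}^\pm$ ($i\in I,r\in\mathbb Z$), $k_i^{\pm1}$ ($i\in I$), $h_{i,m}$ ($i\in I,m\in\mathbb Z\setminus\{0\}$) and relations: the $k_i^{\pm1},h_{j,m}$ commute, $k_ik_i^{-1}=1$; $k_ix_{j,r}^\pm k_i^{-1}=\epsilon^{\pm C_{i,j}}x_{j,r}^\pm$; $[h_{i,m},x_{j,r}^\pm]=\pm\frac1m[mC_{i,j}]_\epsilon x_{j,m+r}^\pm$; $[x_{i,r}^+,x_{j,r'}^-]=\delta_{ij}\frac{\phi^+_{i,r+r'}-\phi^-_{i,r+r'}}{\epsilon-\epsilon^{-1}}$; $x_{i,r+1}^\pm x_{j,r'}^\pm-\epsilon^{\pm C_{ij}}x_{j,r'}^\pm x_{i,r+1}^\pm=\epsilon^{\pm C_{ij}}x_{i,r}^\pm x_{j,r'+1}^\pm-x_{j,r'+1}^\pm x_{i,r}^\pm$; for $j=i+1$ and $j=i-1$ the expression $x_{i,r_1}^\pm x_{i,r_2}^\pm x_{j,r'}^\pm-(\epsilon+\epsilon^{-1})x_{i,r_1}^\pm x_{j,r'}^\pm x_{i,r_2}^\pm+x_{j,r'}^\pm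 x_{i,r_1}^\pm x_{i,r_2}^\pm$ plus the same expression with $r_1,r_2$ exchanged is $0$; $[x_{i,r_1}^\pm,x_{j,r_2}^\pm]=0$ if $i\ne j,j\pm1$. Here $\phi_i^\pm(z)=\sum_{m\ge0}\phi^\pm_{i,\pm m}z^{\pm m}=k_i^{\pm1}\exp\big(\pm(\epsilon-\epsilon^{-1})\sum_{m'\ge1}h_{i,\pm m'}z^{\pm m'}\big)$, $\phi^+_{i,m}=0$ for $m<0$, $\phi^-_{i,m}=0$ for $m>0$. $\chi_\epsilon(V)=\sum_{m\in\mathcal E_\epsilon}m$ means that the module has a basis indexed by $\mathcal E_\epsilon$ whose vector of index $m=\prod Y_{i,\bar l}^{u_{i,\bar l}}$ is an eigenvector of every $\phi_i^\pm(z)$, with eigenvalue the expansion in $z^{\pm1}$ of $\prod_{\bar l}\big(\epsilon\frac{1-z\epsilon^{l-1}}{1-z\epsilon^{l+1}}\big)^{u_{i,\bar l}}$. *)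

theory Defs
  imports
    Complex_Main
    "HOL-Computational_Algebra.Formal_Power_Series"
    "HOL-Library.Function_Algebras"
begin

section \<open>Root data of type $A_n^{(1)}$\<close>

text \<open>The index set $I$ is rendered as the natural numbers \<open>i \<le> n\<close>, cyclically ordered modulo
  \<open>n + 1\<close>. The Cartan matrix below is the one of type $A_n^{(1)}$ for \<open>n \<ge> 2\<close>.\<close>

definition nxt :: "nat \<Rightarrow> nat \<Rightarrow> nat" where
  "nxt n i = (i + 1) mod (n + 1)"

definition prv :: "nat \<Rightarrow> nat \<Rightarrow> nat" where
  "prv n i = (i + n) mod (n + 1)"

definition cartan :: "nat \<Rightarrow> nat \<Rightarrow> nat \<Rightarrow> int" where
  "cartan n i j = (if i = j then 2 else if j = nxt n i \<or> j = prv n i then -1 else 0)"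

text \<open>An element of the dual of $\mathfrak h$ is given by its values on the basis
  \<open>h\<^sub>0, \<dots>, h\<^sub>n, d\<close>; the addition of weights is the pointwise one.\<close>

datatype hbasis = Coroot nat | Deriv

type_synonym weight = "hbasis \<Rightarrow> rat"

definition simple_root :: "nat \<Rightarrow> nat \<Rightarrow> weight" where
  "simple_root n i b = (case b of
      Coroot j \<Rightarrow> if j \<le> n then of_int (cartan n j i) else 0
    | Deriv \<Rightarrow> if i = 0 then 1 else 0)"

definition fund_weight :: "nat \<Rightarrow> weight" where
  "fund_weight i b = (case b of Coroot j \<Rightarrow> if i = j then 1 else 0 | Deriv \<Rightarrow> 0)"

definition varpi :: "nat \<Rightarrow> weight" where
  "varpi l = fund_weight l - fund_weight 0"

definition weight_lattice :: "nat \<Rightarrow> weight set" where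
  "weight_lattice n = {\<mu>. (\<forall>i\<le>n. \<mu> (Coroot i) \<in> \<int>) \<and> (\<forall>i>n. \<mu> (Coroot i) = 0)}"


section \<open>The monomial crystal\<close>

text \<open>\<open>expo m i l\<close> is the exponent of $Y_{i,l}$ in \<open>m\<close>. The type also contains elements violating
  the constraints on monomials (such as a bare $Y_{i,l}$), which are needed to write down products;
  the constraints are imposed by \<open>monomials\<close>.\<close>

record monomial =
  wt :: weight
  expo :: "nat \<Rightarrow> int \<Rightarrow> int"

definition mtimes :: "monomial \<Rightarrow> monomial \<Rightarrow> monomial" (infixl "\<odot>" 70) where
  "m \<odot> m' = \<lparr>wt = wt m + wt m', expo = expo m + expo m'\<rparr>"

definition minv :: "monomial \<Rightarrow> monomial" where
  "minv m = \<lparr>wt = - wt m, expo = - expo m\<rparr>"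

definition mexp :: "weight \<Rightarrow> monomial" where
  "mexp \<mu> = \<lparr>wt = \<mu>, expo = 0\<rparr>"

definition mY :: "nat \<Rightarrow> int \<Rightarrow> monomial" where
  "mY i l = \<lparr>wt = 0, expo = (\<lambda>j k. if j = i \<and> k = l then 1 else 0)\<rparr>"

definition mA :: "nat \<Rightarrow> nat \<Rightarrow> int \<Rightarrow> monomial" where
  "mA n i l = mexp (simple_root n i) \<odot> mY i (l - 1) \<odot> mY i (l + 1)
                \<odot> minv (mY (prv n i) l) \<odot> minv (mY (nxt n i) l)"

definition monomials :: "nat \<Rightarrow> monomial set" where
  "monomials n = {m. wt m \<in> weight_lattice n
      \<and> finite {(i, l). expo m i l \<noteq> 0}
      \<and> (\<forall>i l. i > n \<longrightarrow> expo m i l = 0)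
      \<and> (\<forall>i\<le>n. of_int (\<Sum>l | expo m i l \<noteq> 0. expo m i l) = wt m (Coroot i))}"

definition parity_fun :: "nat \<Rightarrow> (nat \<Rightarrow> int) \<Rightarrow> bool" where
  "parity_fun n s \<longleftrightarrow> (\<forall>i\<le>n. s i \<in> {0, 1}) \<and>
     (\<forall>i\<le>n. \<forall>j\<le>n. cartan n i j = -1 \<longrightarrow> s i + s j = 1)"

definition monomial_group :: "nat \<Rightarrow> (nat \<Rightarrow> int) \<Rightarrow> monomial set" where
  "monomial_group n s =
     {m \<in> monomials n. \<forall>i\<le>n. \<forall>l. l mod 2 = (s i + 1) mod 2 \<longrightarrow> expo m i l = 0}"

text \<open>The sums run over the support of the exponents, so that they are finite; the partial sums
  take finitely many values, so that the maxima over all integers are honest.\<close>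

definition phi_upto :: "monomial \<Rightarrow> nat \<Rightarrow> int \<Rightarrow> int" where
  "phi_upto m i a = (\<Sum>l | l \<le> a \<and> expo m i l \<noteq> 0. expo m i l)"

definition eps_from :: "monomial \<Rightarrow> nat \<Rightarrow> int \<Rightarrow> int" where
  "eps_from m i a = - (\<Sum>l | l \<ge> a \<and> expo m i l \<noteq> 0. expo m i l)"

definition phi :: "monomial \<Rightarrow> nat \<Rightarrow> int" where
  "phi m i = Max (range (phi_upto m i))"

definition eps :: "monomial \<Rightarrow> nat \<Rightarrow> int" where
  "eps m i = Max (range (eps_from m i))"

text \<open>The indices $p_i$ and $q_i$ are meaningful only if \<open>eps m i > 0\<close>, resp.\ \<open>phi m i > 0\<close>.\<close>

definition p_ind :: "monomial \<Rightarrow> nat \<Rightarrow> int" where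
  "p_ind m i = (GREATEST a. eps_from m i a = eps m i)"

definition q_ind :: "monomial \<Rightarrow> nat \<Rightarrow> int" where
  "q_ind m i = (LEAST a. phi_upto m i a = phi m i)"

text \<open>The Kashiwara operators; \<open>None\<close> stands for the value $0$.\<close>

definition e_op :: "nat \<Rightarrow> nat \<Rightarrow> monomial \<Rightarrow> monomial option" where
  "e_op n i m = (if eps m i = 0 then None else Some (m \<odot> mA n i (p_ind m i - 1)))"

definition f_op :: "nat \<Rightarrow> nat \<Rightarrow> monomial \<Rightarrow> monomial option" where
  "f_op n i m = (if phi m i = 0 then None else Some (m \<odot> minv (mA n i (q_ind m i + 1))))"

text \<open>The connected subcrystal of \<open>monomial_group n s\<close> generated by \<open>m0\<close>.\<close>

inductive_set subcrystal :: "nat \<Rightarrow> (nat \<Rightarrow> int) \<Rightarrow> monomial \<Rightarrow> monomial set"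
  for n :: nat and s :: "nat \<Rightarrow> int" and m0 :: monomial where
  base: "m0 \<in> monomial_group n s \<Longrightarrow> m0 \<in> subcrystal n s m0"
| raise: "m \<in> subcrystal n s m0 \<Longrightarrow> i \<le> n \<Longrightarrow> e_op n i m = Some m' \<Longrightarrow> m' \<in> subcrystal n s m0"
| lower: "m \<in> subcrystal n s m0 \<Longrightarrow> i \<le> n \<Longrightarrow> f_op n i m = Some m' \<Longrightarrow> m' \<in> subcrystal n s m0"

definition start_monomial :: "nat \<Rightarrow> nat \<Rightarrow> monomial" where
  "start_monomial n l = mexp (varpi l) \<odot> mY l 0 \<odot> minv (mY 0 (int (min l (n + 1 - l))))"

definition crystal_E :: "nat \<Rightarrow> (nat \<Rightarrow> int) \<Rightarrow> nat \<Rightarrow> monomial set" where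
  "crystal_E n s l = subcrystal n s (start_monomial n l)"


section \<open>Reduction of the second index modulo \<open>N\<close>\<close>

text \<open>A reduced monomial is given by its exponents, residue classes modulo \<open>N\<close> being represented by
  \<open>0, \<dots>, N - 1\<close>; exponents at all other integers are set to \<open>0\<close>. The crystal data of a reduced monomial
  are those of any of its lifts to \<open>crystal_E n s l\<close>; formulas in such data are therefore stated at
  \<open>reduce N m\<close>, simultaneously for all lifts \<open>m\<close>.\<close>

type_synonym rmonomial = "nat \<Rightarrow> int \<Rightarrow> int"

definition reduce :: "nat \<Rightarrow> monomial \<Rightarrow> rmonomial" where
  "reduce N m i c = (if 0 \<le> c \<and> c < int N
     then \<Sum>l | l mod int N = c \<and> expo m i l \<noteq> 0. expo m i l else 0)"

definition crystal_E_red :: "nat \<Rightarrow> (nat \<Rightarrow> int) \<Rightarrow> nat \<Rightarrow> nat \<Rightarrow> rmonomial set" where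
  "crystal_E_red n s l N = reduce N ` crystal_E n s l"

text \<open>The vector attached to the reduction of an element of the crystal, with $v_0 = 0$.\<close>

definition vec_at :: "nat \<Rightarrow> (rmonomial \<Rightarrow> 'v::zero) \<Rightarrow> monomial option \<Rightarrow> 'v" where
  "vec_at N v m = (case m of None \<Rightarrow> 0 | Some m' \<Rightarrow> v (reduce N m'))"


section \<open>Modules over the quantum toroidal algebra at a root of unity\<close>

definition primitive_root_of_unity :: "nat \<Rightarrow> complex \<Rightarrow> bool" where
  "primitive_root_of_unity N e \<longleftrightarrow> N > 0 \<and> e ^ N = 1 \<and> (\<forall>k. 0 < k \<and> k < N \<longrightarrow> e ^ k \<noteq> 1)"

definition qint :: "complex \<Rightarrow> int \<Rightarrow> complex" where
  "qint e l = (e powi l - e powi (- l)) / (e - inverse e)"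

datatype sign = Plus | Minus

definition sg :: "sign \<Rightarrow> int" where
  "sg \<sigma> = (case \<sigma> of Plus \<Rightarrow> 1 | Minus \<Rightarrow> -1)"

text \<open>\<open>X Plus i r\<close>, \<open>X Minus i r\<close>, \<open>K Plus i\<close>, \<open>K Minus i\<close>, \<open>H i m\<close> are the generators
  $x^+_{i,r}$, $x^-_{i,r}$, $k_i$, $k_i^{-1}$, $h_{i,m}$.\<close>

datatype generator = X sign nat int | K sign nat | H nat int

definition cartan_generators :: "nat \<Rightarrow> generator set" where
  "cartan_generators n = {K \<sigma> i |\<sigma> i. i \<le> n} \<union> {H i m |i m. i \<le> n \<and> m \<noteq> 0}"

definition generators :: "nat \<Rightarrow> generator set" where
  "generators n = {X \<sigma> i r |\<sigma> i r. i \<le> n} \<union> cartan_generators n"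

text \<open>Power series $\sum_{t\ge0} F_t z^t$ whose coefficients are operators: the Cauchy product, powers,
  and the exponential of a series with $F_0 = 0$ (for which $F^j$ contributes to degree \<open>t\<close> only if
  \<open>j \<le> t\<close>).\<close>

type_synonym 'v opseries = "nat \<Rightarrow> 'v \<Rightarrow> 'v"

definition ops_mult :: "'v::ab_group_add opseries \<Rightarrow> 'v opseries \<Rightarrow> 'v opseries" where
  "ops_mult F G t v = (\<Sum>a\<le>t. F a (G (t - a) v))"

primrec ops_power :: "'v::ab_group_add opseries \<Rightarrow> nat \<Rightarrow> 'v opseries" where
  "ops_power F 0 = (\<lambda>t v. if t = 0 then v else 0)"
| "ops_power F (Suc j) = ops_mult F (ops_power F j)"

definition ops_exp :: "(complex \<Rightarrow> 'v \<Rightarrow> 'v) \<Rightarrow> 'v::ab_group_add opseries \<Rightarrow> 'v opseries" where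
  "ops_exp scale F t v = (\<Sum>j\<le>t. scale (1 / fact j) (ops_power F j t v))"

text \<open>\<open>phi_gen scale e act \<sigma> i m\<close> is the operator by which $\phi^{\sigma}_{i,m}$ acts when the generators
  act by \<open>act\<close>, obtained from
  $\phi_i^\pm(z) = k_i^{\pm1}\exp(\pm(\epsilon-\epsilon^{-1})\sum_{t\ge1}h_{i,\pm t}z^{\pm t})$;
  the variable of the operator series is $z^{\pm1}$.\<close>

definition phi_gen :: "(complex \<Rightarrow> 'v \<Rightarrow> 'v) \<Rightarrow> complex \<Rightarrow> (generator \<Rightarrow> 'v \<Rightarrow> 'v)
    \<Rightarrow> sign \<Rightarrow> nat \<Rightarrow> int \<Rightarrow> 'v::ab_group_add \<Rightarrow> 'v" where
  "phi_gen scale e act \<sigma> i m v =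
     (if sg \<sigma> * m < 0 then 0
      else act (K \<sigma> i)
        (ops_exp scale
          (\<lambda>t w. if t = 0 then 0
                 else scale (of_int (sg \<sigma>) * (e - inverse e)) (act (H i (sg \<sigma> * int t)) w))
          (nat (sg \<sigma> * m)) v))"

text \<open>A module over the algebra presented by the generators and relations of
  $\mathcal U_\epsilon(sl_{n+1}^{tor})'$ is a complex vector space on which the generators act linearly
  so that the defining relations hold. The underlying space is a subspace \<open>V\<close> of an ambient space;
  the values of \<open>act\<close> outside \<open>V\<close> are irrelevant.\<close>

locale toroidal_module = vector_space scale
  for scale :: "complex \<Rightarrow> 'v::ab_group_add \<Rightarrow> 'v" +
  fixes n :: nat and e :: complex and V :: "'v set" and act :: "generator \<Rightarrow> 'v \<Rightarrow> 'v"
  assumes subspace_V: "subspace V"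
    and act_closed: "g \<in> generators n \<Longrightarrow> v \<in> V \<Longrightarrow> act g v \<in> V"
    and act_add: "g \<in> generators n \<Longrightarrow> v \<in> V \<Longrightarrow> w \<in> V \<Longrightarrow> act g (v + w) = act g v + act g w"
    and act_scale: "g \<in> generators n \<Longrightarrow> v \<in> V \<Longrightarrow> act g (scale c v) = scale c (act g v)"
    and rel_cartan:
      "g \<in> cartan_generators n \<Longrightarrow> g' \<in> cartan_generators n \<Longrightarrow> v \<in> V \<Longrightarrow>
        act g (act g' v) = act g' (act g v)"
    and rel_k_inv: "i \<le> n \<Longrightarrow> v \<in> V \<Longrightarrow> act (K Plus i) (act (K Minus i) v) = v"
    and rel_k_x:
      "i \<le> n \<Longrightarrow> j \<le> n \<Longrightarrow> v \<in> V \<Longrightarrow>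
        act (K Plus i) (act (X \<sigma> j r) (act (K Minus i) v))
          = scale (e powi (sg \<sigma> * cartan n i j)) (act (X \<sigma> j r) v)"
    and rel_h_x:
      "i \<le> n \<Longrightarrow> j \<le> n \<Longrightarrow> m \<noteq> 0 \<Longrightarrow> v \<in> V \<Longrightarrow>
        act (H i m) (act (X \<sigma> j r) v) - act (X \<sigma> j r) (act (H i m) v)
          = scale (of_int (sg \<sigma>) * (1 / of_int m) * qint e (m * cartan n i j))
              (act (X \<sigma> j (m + r)) v)"
    and rel_x_x:
      "i \<le> n \<Longrightarrow> j \<le> n \<Longrightarrow> v \<in> V \<Longrightarrow>
        act (X Plus i r) (act (X Minus j r') v) - act (X Minus j r') (act (X Plus i r) v)
          = (if i = j
             then scale (1 / (e - inverse e))
                    (phi_gen scale e act Plus i (r + r') v - phi_gen scale e act Minus i (r + r') v)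
             else 0)"
    and rel_quadratic:
      "i \<le> n \<Longrightarrow> j \<le> n \<Longrightarrow> v \<in> V \<Longrightarrow>
        act (X \<sigma> i (r + 1)) (act (X \<sigma> j r') v)
          - scale (e powi (sg \<sigma> * cartan n i j)) (act (X \<sigma> j r') (act (X \<sigma> i (r + 1)) v))
        = scale (e powi (sg \<sigma> * cartan n i j)) (act (X \<sigma> i r) (act (X \<sigma> j (r' + 1)) v))
          - act (X \<sigma> j (r' + 1)) (act (X \<sigma> i r) v)"
    and rel_serre:
      "i \<le> n \<Longrightarrow> j = nxt n i \<or> j = prv n i \<Longrightarrow> v \<in> V \<Longrightarrow>
        (act (X \<sigma> i r1) (act (X \<sigma> i r2) (act (X \<sigma> j r') v))
          - scale (e + inverse e) (act (X \<sigma> i r1) (act (X \<sigma> j r') (act (X \<sigma> i r2) v)))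
          + act (X \<sigma> j r') (act (X \<sigma> i r1) (act (X \<sigma> i r2) v)))
        + (act (X \<sigma> i r2) (act (X \<sigma> i r1) (act (X \<sigma> j r') v))
          - scale (e + inverse e) (act (X \<sigma> i r2) (act (X \<sigma> j r') (act (X \<sigma> i r1) v)))
          + act (X \<sigma> j r') (act (X \<sigma> i r2) (act (X \<sigma> i r1) v))) = 0"
    and rel_commute:
      "i \<le> n \<Longrightarrow> j \<le> n \<Longrightarrow> j \<noteq> i \<Longrightarrow> j \<noteq> nxt n i \<Longrightarrow> j \<noteq> prv n i \<Longrightarrow> v \<in> V \<Longrightarrow>
        act (X \<sigma> i r1) (act (X \<sigma> j r2) v) = act (X \<sigma> j r2) (act (X \<sigma> i r1) v)"
begin

definition submodule :: "'v set \<Rightarrow> bool" where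
  "submodule W \<longleftrightarrow> subspace W \<and> W \<subseteq> V \<and> (\<forall>g\<in>generators n. \<forall>w\<in>W. act g w \<in> W)"

definition irreducible_module :: bool where
  "irreducible_module \<longleftrightarrow> V \<noteq> {0} \<and> (\<forall>W. submodule W \<longrightarrow> W = {0} \<or> W = V)"

end

definition indexed_basis ::
  "(complex \<Rightarrow> 'v \<Rightarrow> 'v) \<Rightarrow> 'v::ab_group_add set \<Rightarrow> 'b set \<Rightarrow> ('b \<Rightarrow> 'v) \<Rightarrow> bool" where
  "indexed_basis scale V B v \<longleftrightarrow>
     inj_on v B \<and> \<not> module.dependent scale (v ` B) \<and> module.span scale (v ` B) = V"

text \<open>The expansion of $\epsilon\frac{1-z\epsilon^{l-1}}{1-z\epsilon^{l+1}}$ as a power series in \<open>z\<close>, resp.\ in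
  $z^{-1}$ (after multiplying numerator and denominator by $z^{-1}$). The variable \<open>fps_X\<close> stands for
  \<open>z\<close>, resp.\ for $z^{-1}$. The denominators have an invertible constant term for \<open>e \<noteq> 0\<close>.\<close>

definition Y_eigenvalue :: "complex \<Rightarrow> sign \<Rightarrow> int \<Rightarrow> complex fps" where
  "Y_eigenvalue e \<sigma> l = (case \<sigma> of
      Plus \<Rightarrow> fps_const e * ((1 - fps_const (e powi (l - 1)) * fps_X) /
                              (1 - fps_const (e powi (l + 1)) * fps_X))
    | Minus \<Rightarrow> fps_const e * ((fps_X - fps_const (e powi (l - 1))) /
                               (fps_X - fps_const (e powi (l + 1)))))"

definition eigenvalue_series :: "complex \<Rightarrow> nat \<Rightarrow> sign \<Rightarrow> rmonomial \<Rightarrow> nat \<Rightarrow> complex fps" where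
  "eigenvalue_series e N \<sigma> m i = (\<Prod>l\<in>{0..<int N}. Y_eigenvalue e \<sigma> l powi m i l)"

text \<open>\<open>has_qcharacter scale n e N V act M\<close> renders $\chi_\epsilon(V) = \sum_{m\in M} m$.\<close>

definition has_qcharacter :: "(complex \<Rightarrow> 'v \<Rightarrow> 'v) \<Rightarrow> nat \<Rightarrow> complex \<Rightarrow> nat \<Rightarrow> 'v::ab_group_add set
    \<Rightarrow> (generator \<Rightarrow> 'v \<Rightarrow> 'v) \<Rightarrow> rmonomial set \<Rightarrow> bool" where
  "has_qcharacter scale n e N V act M \<longleftrightarrow>
     (\<exists>w. indexed_basis scale V M w \<and>
        (\<forall>m\<in>M. \<forall>i\<le>n. \<forall>\<sigma>. \<forall>t::nat.
           phi_gen scale e act \<sigma> i (sg \<sigma> * int t) (w m)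
             = scale (fps_nth (eigenvalue_series e N \<sigma> m i) t) (w m)))"

text \<open>The ambient space in which the module of the theorem is realised: functions on reduced
  monomials with pointwise operations.\<close>

definition fscale :: "complex \<Rightarrow> (rmonomial \<Rightarrow> complex) \<Rightarrow> rmonomial \<Rightarrow> complex" where
  "fscale c f = (\<lambda>m. c * f m)"

end

theory Submission
  imports Defs
begin

text \<open>
  Why the theorem is true. Every monomial \<open>m\<close> of the crystal is \<^emph>\<open>thin\<close>: for each \<open>i\<close> it contains
  at most one factor with first index \<open>i\<close>, and this factor is some $Y_{i,h}^{\sigma}$ with
  $\sigma = \pm1$. Put $c = h + \sigma$. If $\sigma = 1$ only $\tilde f_i$ is non-zero on \<open>m\<close>, if
  $\sigma = -1$ only $\tilde e_i$ is, and in both cases the operator multiplies \<open>m\<close> by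
  $A_{i,c}^{-\sigma}$ and replaces $Y_{i,h}^{\sigma}$ by $Y_{i,h+2\sigma}^{-\sigma}$, which has the same
  \<open>c\<close>. So $\tilde e_i$ and $\tilde f_i$ are the two halves of a single involution, the flip at \<open>i\<close>, and
  the exponents $q_i(m) + 1$ and $p_i(\tilde f_i m) - 1$ in the asserted formulas are the same number \<open>c\<close>.

  At a cyclic neighbour \<open>j\<close> of \<open>i\<close> the flip multiplies by $Y_{j,c}^{\sigma}$. In the crystals at
  hand this either creates a factor where there was none, and then $c_j = c_i + \sigma$ afterwards, or
  cancels a factor $Y_{j,c}^{-\sigma}$, and then $c_j = c_i - \sigma$ before. Nothing else
  changes. These rules, collected in the locale \<open>flip_system\<close>, imply all relations of the algebra
  when $x^\pm_{i,r}$ acts as $\epsilon^{r c}$ times the flip and the Cartan generators act diagonally: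
  \<^item> $x^\pm_{i,r} x^\pm_{i,r'} = 0$, and $x^\pm_i x^\pm_j x^\pm_i = 0$ for neighbours, since two equal flips
    at \<open>i\<close> cannot be separated by a single flip at \<open>j\<close>; so each term of the Serre relations vanishes;
  \<^item> for neighbours, the quadratic relation says $\epsilon^{c_j} = \epsilon^{c_i \pm 1}$, where \<open>i\<close> is
    flipped first; at most one of the two orders is possible;
  \<^item> the relation between $h_{i,m}$ and $x^\pm_{j,r}$ compares the eigenvalue of $h_{i,m}$ on the two
    sides of a flip at \<open>j\<close> (lemma \<open>h_eig_flip\<close>);
  \<^item> the series $\phi_i^\pm(z)$ has eigenvalue a constant times $(1 - \alpha z)/(1 - \beta z)$, whose
    coefficients of positive degree form a geometric progression (lemmas \<open>exp_log_ratio\<close>, \<open>phi_gen_act\<close>); on the other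
    hand $[x^+_{i,r}, x^-_{i,r'}]$ is $\pm\epsilon^{(r + r') c}$ on the factors $Y_i^{\pm1}$.

  The module is irreducible because $k_i$ and $h_{i,1}$ separate the basis vectors, so a non-zero
  submodule contains one of them, and flips connect it to all others.

  It remains to know the crystals. For $\ell \in \{1, n\}$ the monomials are
  $Y_{dx,x-1}Y_{d(x-1),x}^{-1}$ with $x \in \mathbb Z$ and $d = \pm1$. For $\ell = r + 1$ they correspond to
  the functions \<open>h\<close> on the cycle $\mathbb Z/(n+1)\mathbb Z$ with steps $\pm1$ and a fixed parity: a local
  minimum at \<open>i\<close> contributes $Y_{i,h(i)}$, a local maximum $Y_{i,h(i)}^{-1}$, and a flip moves a
  local extremum by two. Such functions exist because $n + 1$ is even, and half of the steps go up,
  so there are $\binom{n+1}{r+1}$ of them up to translation. Both families satisfy the axioms of the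
  locale \<open>thin_family\<close>, from which the theorem follows once the reductions are counted.
\<close>

section \<open>Neighbours in the affine Dynkin diagram\<close>

definition adj :: "nat \<Rightarrow> nat \<Rightarrow> nat \<Rightarrow> bool" where
  "adj n i j \<longleftrightarrow> j = nxt n i \<or> j = prv n i"

lemma cartan_adj: "cartan n i j = (if i = j then 2 else if adj n i j then -1 else 0)"
  by (simp add: cartan_def adj_def)

lemma nxt_eq: "i \<le> n \<Longrightarrow> nxt n i = (if i = n then 0 else i + 1)"
  by (auto simp: nxt_def)

lemma prv_eq: "i \<le> n \<Longrightarrow> prv n i = (if i = 0 then n else i - 1)"
  by (auto simp: prv_def mod_if)

lemma nxt_le: "nxt n i \<le> n" and prv_le: "prv n i \<le> n"
  by (simp_all add: nxt_def prv_def less_Suc_eq_le[symmetric])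

lemma nxt_prv: "i \<le> n \<Longrightarrow> nxt n (prv n i) = i" and prv_nxt: "i \<le> n \<Longrightarrow> prv n (nxt n i) = i"
  by (auto simp: nxt_eq prv_eq nxt_le prv_le)

lemma adj_sym: "i \<le> n \<Longrightarrow> j \<le> n \<Longrightarrow> adj n i j \<longleftrightarrow> adj n j i"
  unfolding adj_def using nxt_prv prv_nxt by metis

lemma adj_irrefl: "n \<ge> 1 \<Longrightarrow> i \<le> n \<Longrightarrow> \<not> adj n i i"
  by (auto simp: adj_def nxt_eq prv_eq)

lemma nxt_neq_prv: "n \<ge> 2 \<Longrightarrow> i \<le> n \<Longrightarrow> nxt n i \<noteq> prv n i"
  by (auto simp: nxt_eq prv_eq)

section \<open>Exponentials of diagonal operator series\<close>

lemma fun_sum_apply: "(\<Sum>x\<in>A. g x) c = (\<Sum>x\<in>A. g x c)" for g :: "'x \<Rightarrow> 'y \<Rightarrow> complex"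
  by (induction A rule: infinite_finite_induct) auto

text \<open>A series of operators that are diagonal in the coordinates is, at each coordinate, an ordinary
  power series; products and exponentials of operator series are then computed coordinatewise.\<close>

lemma ops_power_diagonal:
  fixes F :: "(rmonomial \<Rightarrow> complex) opseries" and F' :: "rmonomial \<Rightarrow> complex fps"
  assumes "\<And>t w. F t w = (\<lambda>b. fps_nth (F' b) t * w b)"
  shows "ops_power F j t w = (\<lambda>b. fps_nth (F' b ^ j) t * w b)"
proof (induction j arbitrary: t)
  case 0
  then show ?case by (auto simp: fun_eq_iff)
next
  case (Suc j)
  show ?case
  proof
    fix b
    have "ops_power F (Suc j) t w b = (\<Sum>a\<le>t. fps_nth (F' b) a * (fps_nth (F' b ^ j) (t - a) * w b))"
      by (simp add: ops_mult_def Suc assms fun_sum_apply)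
    also have "\<dots> = fps_nth (F' b ^ Suc j) t * w b"
      by (simp add: fps_mult_nth sum_distrib_right mult.assoc atLeast0AtMost)
    finally show "ops_power F (Suc j) t w b = fps_nth (F' b ^ Suc j) t * w b" .
  qed
qed

lemma ops_exp_diagonal:
  fixes F :: "(rmonomial \<Rightarrow> complex) opseries" and F' :: "rmonomial \<Rightarrow> complex fps"
  assumes "\<And>t w. F t w = (\<lambda>b. fps_nth (F' b) t * w b)"
  shows "ops_exp fscale F t w = (\<lambda>b. fps_nth (fps_exp 1 oo F' b) t * w b)"
proof
  fix b
  show "ops_exp fscale F t w b = fps_nth (fps_exp 1 oo F' b) t * w b"
    by (simp add: ops_exp_def fun_sum_apply fscale_def ops_power_diagonal[OF assms] fps_compose_nth
        sum_distrib_right atLeast0AtMost mult.assoc)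
qed

text \<open>The logarithm of $(1 - \alpha X)/(1 - \beta X)$.\<close>

definition log_ratio :: "complex \<Rightarrow> complex \<Rightarrow> complex fps" where
  "log_ratio \<beta> \<alpha> = Abs_fps (\<lambda>t. if t = 0 then 0 else (\<beta> ^ t - \<alpha> ^ t) / of_nat t)"

text \<open>Both sides have constant term 1 and the same logarithmic derivative
  $\beta/(1 - \beta X) - \alpha/(1 - \alpha X)$.\<close>

lemma exp_log_ratio:
  "fps_exp 1 oo log_ratio \<beta> \<alpha> = (1 - fps_const \<alpha> * fps_X) / (1 - fps_const \<beta> * fps_X)"
proof -
  define F where "F = log_ratio \<beta> \<alpha>"
  define A where "A = 1 - fps_const \<alpha> * fps_X"
  define B where "B = 1 - fps_const \<beta> * fps_X"
  define T where "T = A / B"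
  define G where "G = fps_exp 1 oo F"
  have F0: "fps_nth F 0 = 0" by (simp add: F_def log_ratio_def)
  have B0: "fps_nth B 0 = 1" and A0: "fps_nth A 0 = 1" by (simp_all add: A_def B_def)
  have TB: "T * B = A"
    using B0 by (simp add: T_def fps_divide_unit mult.assoc inverse_mult_eq_1)
  have T0: "fps_nth T 0 = 1" by (simp add: T_def fps_divide_nth_0 A0 B0)
  have nz: "A \<noteq> 0" "B \<noteq> 0" "T \<noteq> 0" using A0 B0 T0 by auto
  have AB: "fps_const \<beta> * A - fps_const \<alpha> * B = fps_const (\<beta> - \<alpha>)"
    by (simp add: A_def B_def algebra_simps fps_const_sub[symmetric] del: fps_const_sub)
  have dF: "fps_deriv F * (A * B) = fps_const (\<beta> - \<alpha>)"
  proof -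
    define P where "P = (\<lambda>c. Abs_fps (\<lambda>t. c ^ Suc t) :: complex fps)"
    have P: "P c * (1 - fps_const c * fps_X) = fps_const c" for c
    proof (rule fps_ext)
      fix t
      show "fps_nth (P c * (1 - fps_const c * fps_X)) t = fps_nth (fps_const c) t"
        by (cases t) (simp_all add: algebra_simps fps_X_mult_nth P_def)
    qed
    have "fps_deriv F = P \<beta> - P \<alpha>"
      by (rule fps_ext) (simp add: F_def log_ratio_def P_def field_simps del: of_nat_Suc)
    then have "fps_deriv F * (A * B) = (P \<beta> * B) * A - (P \<alpha> * A) * B"
      by (simp only: left_diff_distrib right_diff_distrib mult_ac)
    then show ?thesis
      using P[of \<alpha>] P[of \<beta>] AB by (simp only: A_def B_def)
  qed
  have dT: "fps_deriv T * B = fps_const \<beta> * T - fps_const \<alpha>"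
  proof -
    have "fps_deriv (T * B) = fps_deriv A" by (simp only: TB)
    moreover have "fps_deriv A = - fps_const \<alpha>" "fps_deriv B = - fps_const \<beta>"
      by (simp_all add: A_def B_def)
    ultimately show ?thesis
      by (simp add: algebra_simps del: fps_const_neg)
  qed
  have "fps_deriv T * (A * B) = (fps_deriv T * B) * A" by (simp only: mult_ac)
  also have "\<dots> = fps_const \<beta> * T * A - fps_const \<alpha> * (T * B)"
    unfolding dT TB by (simp only: left_diff_distrib)
  also have "\<dots> = T * (fps_const \<beta> * A - fps_const \<alpha> * B)"
    by (simp only: right_diff_distrib mult_ac)
  also have "\<dots> = (fps_deriv F * T) * (A * B)"
    unfolding AB dF[symmetric] by (simp only: mult_ac)
  finally have dT': "fps_deriv T = fps_deriv F * T" using nz by simp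
  have dG: "fps_deriv G = fps_deriv F * G"
    using F0 by (simp add: G_def fps_compose_deriv mult.commute)
  have TI: "T * inverse T = 1" using T0 by (intro inverse_mult_eq_1') simp
  have "fps_deriv T * (inverse T)\<^sup>2 = fps_deriv F * inverse T * (T * inverse T)"
    unfolding dT' power2_eq_square by (simp only: mult_ac)
  then have "fps_deriv (inverse T) = - fps_deriv F * inverse T"
    using T0 by (simp add: fps_inverse_deriv TI)
  then have "fps_deriv (G * inverse T) = 0"
    by (simp add: dG mult_ac)
  then have "G * inverse T = fps_const (fps_nth (G * inverse T) 0)"
    by (simp only: fps_deriv_eq_0_iff)
  also have "\<dots> = 1" using T0 F0 by (simp add: G_def)
  finally have "G * inverse T * T = T" by simp
  then have "G = T" using TI by (simp add: mult_ac)
  then show ?thesis by (simp only: G_def T_def A_def B_def F_def)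
qed

lemma exp_log_ratio_nth:
  "fps_nth (fps_exp 1 oo log_ratio \<beta> \<alpha>) t = (if t = 0 then 1 else \<beta> ^ t - \<alpha> * \<beta> ^ (t - 1))"
proof -
  let ?S = "Abs_fps (\<lambda>t. if t = 0 then 1 else \<beta> ^ t - \<alpha> * \<beta> ^ (t - 1))"
  let ?A = "1 - fps_const \<alpha> * fps_X" and ?B = "1 - fps_const \<beta> * fps_X"
  have "?S * ?B = ?A"
  proof (rule fps_ext)
    fix t
    consider "t = 0" | "t = 1" | k where "t = Suc (Suc k)" by (metis One_nat_def not0_implies_Suc)
    then show "fps_nth (?S * ?B) t = fps_nth ?A t"
      by cases (simp_all add: algebra_simps fps_X_mult_nth)
  qed
  moreover have "?B \<noteq> 0" 
  proof
    assume "?B = 0"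
    then have "fps_nth ?B 0 = 0" by simp
    then show False by simp
  qed
  ultimately have "?A / ?B = ?S"
    using nonzero_mult_div_cancel_right[of ?B ?S] by simp
  then show ?thesis unfolding exp_log_ratio by simp
qed

section \<open>Flip systems and their modules\<close>

lemma vector_space_fscale: "vector_space fscale"
  by unfold_locales (auto simp: fscale_def fun_eq_iff algebra_simps)

text \<open>A finite set of states with local data at each node \<open>i\<close> of the cycle: \<open>st b i\<close> is the exponent
  $\sigma$ of the only factor $Y_{i,h}^{\sigma}$ of the state \<open>b\<close> (or 0 if there is none), and \<open>u b i\<close> is
  $\epsilon^{c}$ with $c = h + \sigma$. Only this power of $\epsilon$ occurs in the module, which is why it,
  and not the position \<open>c\<close> itself, is taken as a primitive; where \<open>st b i = 0\<close> its value is
  meaningless. The flip at \<open>i\<close> is $\tilde f_i$ if \<open>st b i = 1\<close> and $\tilde e_i$ if \<open>st b i = -1\<close>.\<close>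

locale flip_system =
  fixes n :: nat and e :: complex and B :: "rmonomial set"
    and st :: "rmonomial \<Rightarrow> nat \<Rightarrow> int" and u :: "rmonomial \<Rightarrow> nat \<Rightarrow> complex"
    and flip :: "nat \<Rightarrow> rmonomial \<Rightarrow> rmonomial"
  assumes e_nz: "e \<noteq> 0" and e_sq: "e\<^sup>2 \<noteq> 1"
    and finite_B: "finite B" and B_nonempty: "B \<noteq> {}"
    and st_range: "b \<in> B \<Longrightarrow> i \<le> n \<Longrightarrow> st b i \<in> {-1, 0, 1}"
    and u_nz: "b \<in> B \<Longrightarrow> i \<le> n \<Longrightarrow> u b i \<noteq> 0"
    and flip_closed: "b \<in> B \<Longrightarrow> i \<le> n \<Longrightarrow> st b i \<noteq> 0 \<Longrightarrow> flip i b \<in> B"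
    and flip_flip: "b \<in> B \<Longrightarrow> i \<le> n \<Longrightarrow> st b i \<noteq> 0 \<Longrightarrow> flip i (flip i b) = b"
    and st_flip: "b \<in> B \<Longrightarrow> i \<le> n \<Longrightarrow> st b i \<noteq> 0 \<Longrightarrow> st (flip i b) i = - st b i"
    and u_flip: "b \<in> B \<Longrightarrow> i \<le> n \<Longrightarrow> st b i \<noteq> 0 \<Longrightarrow> u (flip i b) i = u b i"
    and st_adj: "b \<in> B \<Longrightarrow> i \<le> n \<Longrightarrow> st b i \<noteq> 0 \<Longrightarrow> j \<le> n \<Longrightarrow> adj n i j \<Longrightarrow>
        st (flip i b) j = st b j + st b i"
    and u_adj: "b \<in> B \<Longrightarrow> i \<le> n \<Longrightarrow> st b i \<noteq> 0 \<Longrightarrow> j \<le> n \<Longrightarrow> adj n i j \<Longrightarrow>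
        st b j = 0 \<Longrightarrow> u (flip i b) j = u b i * e powi st b i"
    and st_far: "b \<in> B \<Longrightarrow> i \<le> n \<Longrightarrow> st b i \<noteq> 0 \<Longrightarrow> j \<le> n \<Longrightarrow> j \<noteq> i \<Longrightarrow> \<not> adj n i j \<Longrightarrow>
        st (flip i b) j = st b j"
    and u_far: "b \<in> B \<Longrightarrow> i \<le> n \<Longrightarrow> st b i \<noteq> 0 \<Longrightarrow> j \<le> n \<Longrightarrow> j \<noteq> i \<Longrightarrow> \<not> adj n i j \<Longrightarrow>
        u (flip i b) j = u b j"
    and flip_far: "b \<in> B \<Longrightarrow> i \<le> n \<Longrightarrow> st b i \<noteq> 0 \<Longrightarrow> j \<le> n \<Longrightarrow> st b j \<noteq> 0 \<Longrightarrow> j \<noteq> i \<Longrightarrow>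
        \<not> adj n i j \<Longrightarrow> flip j (flip i b) = flip i (flip j b)"
    and separated: "b \<in> B \<Longrightarrow> b' \<in> B \<Longrightarrow>
        (\<And>i. i \<le> n \<Longrightarrow> st b i = st b' i) \<Longrightarrow>
        (\<And>i. i \<le> n \<Longrightarrow> st b i \<noteq> 0 \<Longrightarrow> u b i = u b' i) \<Longrightarrow> b = b'"
    and connected: "b \<in> B \<Longrightarrow> b' \<in> B \<Longrightarrow>
        (b, b') \<in> {(c, flip i c) | c i. c \<in> B \<and> i \<le> n \<and> st c i \<noteq> 0}\<^sup>*"
begin

text \<open>Two neighbouring factors are $Y_{i,h}^{\sigma}$ and $Y_{j,h+\sigma}^{-\sigma}$. The flip at \<open>i\<close>
  cancels the latter, so this follows from \<open>u_adj\<close> applied at the flipped state, where \<open>j\<close> is neutral.\<close>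

lemma opposite_adjacent:
  assumes "b \<in> B" "i \<le> n" "st b i \<noteq> 0" "j \<le> n" "adj n i j" "st b j \<noteq> 0"
  shows "st b j = - st b i" "u b j = u b i * e powi (- st b i)"
proof -
  let ?c = "flip i b"
  have c: "?c \<in> B" using assms flip_closed by simp
  have *: "st ?c j = st b j + st b i" using st_adj assms by simp
  moreover have "st ?c j \<in> {-1, 0, 1}" "st b i \<in> {-1, 0, 1}" "st b j \<in> {-1, 0, 1}"
    using st_range c assms by blast+
  ultimately show s: "st b j = - st b i" using assms by auto
  have "u (flip i ?c) j = u ?c i * e powi st ?c i"
    using assms c * s st_flip by (intro u_adj) auto
  then show "u b j = u b i * e powi (- st b i)" using assms flip_flip u_flip st_flip by simp
qed

text \<open>The coefficients of the logarithm of $(1 - \alpha z)/(1 - \beta z)$ for $\beta = \epsilon^{c}$ and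
  $\alpha = \epsilon^{c - 2\sigma}$, divided by $\epsilon - \epsilon^{-1}$. They are 0 at neutral nodes.\<close>

definition h_eig :: "rmonomial \<Rightarrow> nat \<Rightarrow> int \<Rightarrow> complex" where
  "h_eig b i m = (u b i powi m - (u b i * e powi (- 2 * st b i)) powi m) / (of_int m * (e - inverse e))"

text \<open>Operators are written on functions, that is, as pull-backs: $x^+_{i,a}$ sends the indicator
  function of \<open>b\<close> to a multiple of that of $\tilde e_i b$, so its value at a state \<open>b\<close> involves
  $\tilde f_i b$, and it is supported on the states with \<open>st b i = 1\<close>.\<close>

definition act :: "generator \<Rightarrow> (rmonomial \<Rightarrow> complex) \<Rightarrow> rmonomial \<Rightarrow> complex" where
  "act g f b = (if b \<in> B then case g of
       X \<sigma> i a \<Rightarrow> if st b i = sg \<sigma> then u b i powi a * f (flip i b) else 0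
     | K \<sigma> i \<Rightarrow> e powi (sg \<sigma> * st b i) * f b
     | H i m \<Rightarrow> h_eig b i m * f b else 0)"

definition V :: "(rmonomial \<Rightarrow> complex) set" where
  "V = {f. \<forall>b. b \<notin> B \<longrightarrow> f b = 0}"

definition phi_eig :: "sign \<Rightarrow> rmonomial \<Rightarrow> nat \<Rightarrow> int \<Rightarrow> complex" where
  "phi_eig \<sigma> b i m = (if sg \<sigma> * m < 0 then 0 else if m = 0 then e powi (sg \<sigma> * st b i)
     else of_int (sg \<sigma> * st b i) * (e - inverse e) * u b i powi m)"

lemma e_diff_nz: "e - inverse e \<noteq> 0"
  using e_nz e_sq by (auto simp: field_simps power2_eq_square)

lemma sg_cases: "sg \<sigma> = 1 \<or> sg \<sigma> = -1" "sg \<sigma> * sg \<sigma> = 1" "sg \<sigma> \<noteq> 0"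
  by (cases \<sigma>; simp add: sg_def)+

lemma act_out: "b \<notin> B \<Longrightarrow> act g f b = 0"
  by (simp add: act_def)

lemma act_X: "b \<in> B \<Longrightarrow> act (X \<sigma> i a) f b = (if st b i = sg \<sigma> then u b i powi a * f (flip i b) else 0)"
  and act_K: "b \<in> B \<Longrightarrow> act (K \<sigma> i) f b = e powi (sg \<sigma> * st b i) * f b"
  and act_H: "b \<in> B \<Longrightarrow> act (H i m) f b = h_eig b i m * f b"
  by (simp_all add: act_def)

lemma phi_eig_nth:
  assumes "b \<in> B" "i \<le> n"
  shows "phi_eig \<sigma> b i (sg \<sigma> * int t) = e powi (sg \<sigma> * st b i) *
    fps_nth (fps_exp 1 oo log_ratio (u b i powi sg \<sigma>) ((u b i * e powi (- 2 * st b i)) powi sg \<sigma>)) t"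
proof (cases "t = 0")
  case True
  then show ?thesis by (simp add: exp_log_ratio_nth phi_eig_def)
next
  case False
  define \<beta> where "\<beta> = u b i powi sg \<sigma>"
  define \<alpha> where "\<alpha> = (u b i * e powi (- 2 * st b i)) powi sg \<sigma>"
  have \<alpha>: "\<alpha> = \<beta> * e powi (- 2 * sg \<sigma> * st b i)"
    by (simp add: \<alpha>_def \<beta>_def power_int_mult_distrib flip: power_int_mult)
       (simp add: mult_ac)
  have "\<beta> ^ t = \<beta> * \<beta> ^ (t - 1)" using False by (cases t) auto
  then have "e powi (sg \<sigma> * st b i) * (\<beta> ^ t - \<alpha> * \<beta> ^ (t - 1))
      = (e powi (sg \<sigma> * st b i) - e powi (sg \<sigma> * st b i) * e powi (- 2 * sg \<sigma> * st b i)) * \<beta> ^ t"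
    unfolding \<alpha> by (simp add: algebra_simps)
  also have "e powi (sg \<sigma> * st b i) * e powi (- 2 * sg \<sigma> * st b i) = e powi (- (sg \<sigma> * st b i))"
    using e_nz by (simp flip: power_int_add)
  also have "e powi (sg \<sigma> * st b i) - e powi (- (sg \<sigma> * st b i)) = of_int (sg \<sigma> * st b i) * (e - inverse e)"
    using st_range[OF assms] sg_cases(1)[of \<sigma>] by (auto simp: power_int_minus)
  also have "of_int (sg \<sigma> * st b i) * (e - inverse e) * \<beta> ^ t = phi_eig \<sigma> b i (sg \<sigma> * int t)"
    using False sg_cases(2)[of \<sigma>] sg_cases(3)[of \<sigma>]
    by (simp add: phi_eig_def \<beta>_def power_int_mult mult.assoc[symmetric])
  finally show ?thesis
    using False unfolding \<beta>_def[symmetric] \<alpha>_def[symmetric] by (simp add: exp_log_ratio_nth)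
qed

text \<open>At each state the exponent in the definition of $\phi_i^\pm(z)$ is the series \<open>log_ratio\<close> with
  $\beta = u^{\pm1}$ and $\alpha = (u\epsilon^{-2\sigma})^{\pm1}$.\<close>

lemma phi_gen_act:
  assumes i: "i \<le> n"
  shows "phi_gen fscale e act \<sigma> i m f = (\<lambda>b. if b \<in> B then phi_eig \<sigma> b i m * f b else 0)"
proof (cases "sg \<sigma> * m < 0")
  case True
  then show ?thesis by (simp add: phi_gen_def phi_eig_def fun_eq_iff)
next
  case False
  define t where "t = nat (sg \<sigma> * m)"
  have m: "m = sg \<sigma> * int t" using False sg_cases[of \<sigma>] by (auto simp: t_def)
  define F' where "F' = (\<lambda>b. if b \<in> B
    then log_ratio (u b i powi sg \<sigma>) ((u b i * e powi (- 2 * st b i)) powi sg \<sigma>) else 0)"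
  let ?F = "(\<lambda>t w. if t = 0 then 0
                 else fscale (of_int (sg \<sigma>) * (e - inverse e)) (act (H i (sg \<sigma> * int t)) w))"
  have "?F t w b = fps_nth (F' b) t * w b" for t w b
  proof (cases "t = 0 \<or> b \<notin> B")
    case True
    then show ?thesis by (auto simp: F'_def log_ratio_def fscale_def act_out)
  next
    case False
    have cancel: "x * d * (y / (x * k * d) * z) = y / k * z" if "x \<noteq> 0" "d \<noteq> 0" for x d y k z :: complex
      using that by simp
    show ?thesis using False e_diff_nz sg_cases(3)[of \<sigma>]
      by (simp add: F'_def log_ratio_def fscale_def act_H h_eig_def power_int_mult cancel
          del: mult_eq_0_iff times_divide_eq_left times_divide_eq_right)
  qed
  then have *: "ops_exp fscale ?F t f = (\<lambda>b. fps_nth (fps_exp 1 oo F' b) t * f b)"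
    by (intro ops_exp_diagonal) (simp add: fun_eq_iff)
  have "phi_gen fscale e act \<sigma> i m f = act (K \<sigma> i) (\<lambda>b. fps_nth (fps_exp 1 oo F' b) t * f b)"
    using False unfolding phi_gen_def t_def[symmetric] * by simp
  then show ?thesis
    using i by (auto simp: fun_eq_iff act_K act_out F'_def m phi_eig_nth)
qed

text \<open>The next three lemmas compute the product of two generators $x^\pm_i$, $x^\pm_j$ according to the
  position of \<open>j\<close> relative to \<open>i\<close>; all relations among these generators are read off from them. As
  operators are pull-backs, the first factor determines the first flip of the argument.\<close>

lemma act_X_same:
  assumes "b \<in> B" "i \<le> n"
  shows "act (X \<sigma> i a) (act (X \<sigma>' i a') f) b
    = (if st b i = sg \<sigma> \<and> sg \<sigma>' = - sg \<sigma> then u b i powi (a + a') * f b else 0)"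
  using assms sg_cases(3)[of \<sigma>] flip_closed[of b i] flip_flip[of b i] st_flip[of b i] u_flip[of b i] u_nz[of b i]
  by (auto simp: act_X power_int_add)

text \<open>For neighbours the product is non-zero only if the signs agree and \<open>j\<close> is neutral: flipping \<open>i\<close>
  adds \<open>st b i\<close> to the value at \<open>j\<close>, and only the value 0 can become \<open>sg \<sigma>'\<close> in this way.\<close>

lemma act_X_adj:
  assumes "b \<in> B" "i \<le> n" "j \<le> n" "adj n i j"
  shows "act (X \<sigma> i a) (act (X \<sigma>' j a') f) b
    = (if st b i = sg \<sigma> \<and> st b j = 0 \<and> \<sigma>' = \<sigma> 
       then u b i powi a * (u b i * e powi sg \<sigma>) powi a' * f (flip j (flip i b)) else 0)"
proof (cases "st b i = sg \<sigma>")
  case True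
  then have nz: "st b i \<noteq> 0" using sg_cases(3) by simp
  note c = flip_closed[OF assms(1,2) nz]
  have s: "st (flip i b) j = st b j + sg \<sigma>" using st_adj assms nz True by simp
  have "sg \<sigma>' = sg \<sigma> \<longleftrightarrow> \<sigma>' = \<sigma>" by (cases \<sigma>; cases \<sigma>') (simp_all add: sg_def)
  moreover have "st b j = 0 \<or> st b j = - sg \<sigma>" using opposite_adjacent(1) assms nz True by metis
  ultimately show ?thesis
    using True assms c s u_adj[OF assms(1,2) nz assms(3,4)] sg_cases(3)[of \<sigma>'] by (auto simp: act_X)
next
  case False
  then show ?thesis using assms by (simp add: act_X)
qed

lemma act_X_far:
  assumes "b \<in> B" "i \<le> n" "j \<le> n" "j \<noteq> i" "\<not> adj n i j"
  shows "act (X \<sigma> i a) (act (X \<sigma>' j a') f) b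
    = (if st b i = sg \<sigma> \<and> st b j = sg \<sigma>' then u b i powi a * u b j powi a' * f (flip j (flip i b)) else 0)"
  using assms sg_cases(3)[of \<sigma>] flip_closed[of b i] st_far[of b i j] u_far[of b i j]
  by (auto simp: act_X)

lemma act_X_far_commute:
  assumes "b \<in> B" "i \<le> n" "j \<le> n" "j \<noteq> i" "\<not> adj n i j"
  shows "act (X \<sigma> i a) (act (X \<sigma>' j a') f) b = act (X \<sigma>' j a') (act (X \<sigma> i a) f) b"
proof -
  have "\<not> adj n j i" using assms adj_sym by blast
  then show ?thesis
    using assms flip_far[of b i j] sg_cases(3)[of \<sigma>] sg_cases(3)[of \<sigma>']
    by (auto simp: act_X_far)
qed

text \<open>At the flipped node \<open>j\<close> the root $\beta$ stays and $\alpha$ moves from $\beta\epsilon^{-2\sigma}$ to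
  $\beta\epsilon^{2\sigma}$. At a neighbour, a factor appears or disappears whose two roots are
  $w\epsilon^{\sigma}$ and $w\epsilon^{-\sigma}$ with \<open>w = u b j\<close>, in either case with the same difference.\<close>

lemma h_eig_flip:
  assumes b: "b \<in> B" and i: "i \<le> n" and j: "j \<le> n" and s: "st b j = sg \<sigma>" and m: "m \<noteq> 0"
  shows "h_eig b i m - h_eig (flip j b) i m
    = of_int (sg \<sigma>) * (1 / of_int m) * qint e (m * cartan n i j) * u b j powi m"
proof -
  have nz: "st b j \<noteq> 0" using s sg_cases(3) by simp
  let ?w = "u b j powi m" and ?d = "of_int m * (e - inverse e)"
  have d: "?d \<noteq> 0" using m e_diff_nz by simp
  have h: "h_eig c i m = (u c i powi m - u c i powi m * e powi (- 2 * st c i * m)) / ?d" for c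
    by (simp add: h_eig_def power_int_mult_distrib flip: power_int_mult)
  have sg_powi: "of_int (sg \<sigma>) * (e powi k - e powi (- k)) = e powi (sg \<sigma> * k) - e powi (- sg \<sigma> * k)" for k
    by (cases \<sigma>) (simp_all add: sg_def)
  define q where "q = m * cartan n i j"
  have R: "of_int (sg \<sigma>) * (1 / of_int m) * qint e q * ?w
      = (e powi (sg \<sigma> * q) - e powi (- sg \<sigma> * q)) * ?w / ?d"
    unfolding sg_powi[symmetric] by (simp add: qint_def)
  consider "i = j" | "i \<noteq> j" "adj n j i" "st b i = 0" | "i \<noteq> j" "adj n j i" "st b i \<noteq> 0" | "i \<noteq> j" "\<not> adj n j i" by blast
  then have "(u b i powi m - u b i powi m * e powi (- 2 * st b i * m))
      - (u (flip j b) i powi m - u (flip j b) i powi m * e powi (- 2 * st (flip j b) i * m))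
      = (e powi (sg \<sigma> * q) - e powi (- sg \<sigma> * q)) * ?w"
  proof cases
    case 1
    then show ?thesis using b j nz s st_flip u_flip by (simp add: q_def cartan_adj algebra_simps)
  next
    case 2
    have c: "cartan n i j = -1" using 2 adj_sym i j by (simp add: cartan_adj)
    have "u (flip j b) i powi m = ?w * e powi (sg \<sigma> * m)"
      using u_adj[OF b j nz i] 2 s by (simp add: power_int_mult_distrib flip: power_int_mult)
    moreover have "e powi (sg \<sigma> * m) * e powi (- 2 * sg \<sigma> * m) = e powi (- sg \<sigma> * m)"
      using e_nz by (simp add: mult.commute flip: power_int_add)
    ultimately show ?thesis using st_adj[OF b j nz i] 2 s by (simp add: q_def c algebra_simps)
  next
    case 3
    have c: "cartan n i j = -1" using 3 adj_sym i j by (simp add: cartan_adj)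
    have sti: "st b i = - sg \<sigma>" using opposite_adjacent(1)[OF b j nz i] 3 s by simp
    have "u b i powi m = ?w * e powi (- sg \<sigma> * m)"
      using opposite_adjacent(2)[OF b j nz i] 3 s by (simp add: power_int_mult_distrib flip: power_int_mult)
    moreover have "e powi (- sg \<sigma> * m) * e powi (2 * sg \<sigma> * m) = e powi (sg \<sigma> * m)"
      using e_nz by (simp add: mult.commute flip: power_int_add)
    ultimately show ?thesis using st_adj[OF b j nz i] 3 s sti by (simp add: q_def c algebra_simps)
  next
    case 4
    have c: "cartan n i j = 0" using 4 adj_sym i j by (simp add: cartan_adj)
    then show ?thesis using 4 st_far[OF b j nz i] u_far[OF b j nz i] by (simp add: q_def)
  qed
  then show ?thesis unfolding q_def[symmetric] R h by (simp flip: diff_divide_distrib)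
qed

lemma phi_eig_diff:
  assumes "b \<in> B" "i \<le> n"
  shows "(phi_eig Plus b i m - phi_eig Minus b i m) / (e - inverse e) = of_int (st b i) * u b i powi m"
proof -
  have "e powi st b i - e powi (- st b i) = of_int (st b i) * (e - inverse e)"
    using st_range[OF assms] by (auto simp: power_int_minus)
  then show ?thesis using e_diff_nz by (auto simp: phi_eig_def sg_def field_simps)
qed

text \<open>All relations are checked at a single state \<open>b\<close>; outside \<open>B\<close> both sides are 0.\<close>

lemma toroidal_module_act: "toroidal_module fscale n e V act"
proof -
  interpret vector_space fscale by (rule vector_space_fscale)
  show ?thesis
  proof
    show "subspace V"
      by (simp add: subspace_def V_def fscale_def)
  next
    fix g v assume "g \<in> generators n" "v \<in> V"
    show "act g v \<in> V" by (simp add: V_def act_out)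
  next
    fix g v w assume "g \<in> generators n"
    show "act g (v + w) = act g v + act g w"
      by (rule ext) (simp add: act_def algebra_simps split: generator.split)
  next
    fix g v c assume "g \<in> generators n"
    show "act g (fscale c v) = fscale c (act g v)"
      by (rule ext) (simp add: act_def fscale_def algebra_simps split: generator.split)
  next
    fix g g' v assume "g \<in> cartan_generators n" "g' \<in> cartan_generators n"
    then show "act g (act g' v) = act g' (act g v)"
      by (intro ext) (auto simp: act_def cartan_generators_def)
  next
    fix i v assume "i \<le> n" "v \<in> V"
    then show "act (K Plus i) (act (K Minus i) v) = v"
      using e_nz by (intro ext) (auto simp: act_def V_def sg_def power_int_minus)
  next
    fix i j v \<sigma> r assume ij: "i \<le> n" "j \<le> n" and "v \<in> V"
    show "act (K Plus i) (act (X \<sigma> j r) (act (K Minus i) v))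
          = fscale (e powi (sg \<sigma> * cartan n i j)) (act (X \<sigma> j r) v)"
    proof
      fix b
      show "act (K Plus i) (act (X \<sigma> j r) (act (K Minus i) v)) b
          = fscale (e powi (sg \<sigma> * cartan n i j)) (act (X \<sigma> j r) v) b"
      proof (cases "b \<in> B \<and> st b j = sg \<sigma>")
        case False
        then show ?thesis by (auto simp: act_def fscale_def)
      next
        case True
        then have nz: "st b j \<noteq> 0" using sg_cases(3) by simp
        have "st b i - st (flip j b) i = sg \<sigma> * cartan n i j"
          using True nz ij st_flip[of b j] st_adj[of b j i] st_far[of b j i] adj_sym[of i n j]
          by (auto simp: cartan_adj)
        then have "e powi st b i * e powi (- st (flip j b) i) = e powi (sg \<sigma> * cartan n i j)"
          using e_nz by (simp flip: power_int_add)
        then show ?thesis using True ij nz flip_closed[of b j]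
          by (simp add: act_def fscale_def sg_def)
      qed
    qed
  next
    fix i j v \<sigma> r and m :: int assume ij: "i \<le> n" "j \<le> n" and m: "m \<noteq> 0"
    show "act (H i m) (act (X \<sigma> j r) v) - act (X \<sigma> j r) (act (H i m) v)
          = fscale (of_int (sg \<sigma>) * (1 / of_int m) * qint e (m * cartan n i j))
              (act (X \<sigma> j (m + r)) v)" (is "?L = ?R")
    proof
      fix b
      show "?L b = ?R b"
      proof (cases "b \<in> B \<and> st b j = sg \<sigma>")
        case False
        then show ?thesis by (auto simp: act_def fscale_def)
      next
        case True
        then have nz: "st b j \<noteq> 0" using sg_cases(3) by simp
        have "?L b = (h_eig b i m - h_eig (flip j b) i m) * (u b j powi r * v (flip j b))"
          using True ij nz flip_closed[of b j] by (simp add: act_X act_H algebra_simps)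
        also have "\<dots> = of_int (sg \<sigma>) * (1 / of_int m) * qint e (m * cartan n i j)
             * (u b j powi (m + r) * v (flip j b))"
          using True ij m h_eig_flip[of b i j \<sigma> m] u_nz[of b j] by (simp add: power_int_add)
        also have "\<dots> = ?R b" using True by (simp add: fscale_def act_X)
        finally show ?thesis .
      qed
    qed
  next
    fix i j v r r' assume ij: "i \<le> n" "j \<le> n"
    show "act (X Plus i r) (act (X Minus j r') v) - act (X Minus j r') (act (X Plus i r) v)
          = (if i = j
             then fscale (1 / (e - inverse e))
                    (phi_gen fscale e act Plus i (r + r') v - phi_gen fscale e act Minus i (r + r') v)
             else 0)" (is "?L = ?R")
    proof
      fix b
      consider "b \<notin> B" | "b \<in> B" "i = j" | "b \<in> B" "i \<noteq> j" "adj n i j" | "b \<in> B" "i \<noteq> j" "\<not> adj n i j" by blast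
      then show "?L b = ?R b"
      proof cases
        case 1
        then show ?thesis using ij by (simp add: act_out phi_gen_act fscale_def)
      next
        case 2
        have "?R b = (phi_eig Plus b i (r + r') - phi_eig Minus b i (r + r')) / (e - inverse e) * v b"
          using 2 ij by (simp add: phi_gen_act fscale_def algebra_simps diff_divide_distrib)
        also have "\<dots> = of_int (st b i) * u b i powi (r + r') * v b"
          using phi_eig_diff 2 ij by simp
        also have "\<dots> = ?L b"
          using st_range[of b i] 2 ij by (auto simp: act_X_same sg_def add.commute)
        finally show ?thesis by simp
      next
        case 3
        then show ?thesis using ij adj_sym[of i n j] by (simp add: act_X_adj)
      next
        case 4
        then show ?thesis using ij act_X_far_commute[of b i j] by simp
      qed
    qed
  next
    fix i j v \<sigma> r r' assume ij: "i \<le> n" "j \<le> n"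
    show "act (X \<sigma> i (r + 1)) (act (X \<sigma> j r') v)
          - fscale (e powi (sg \<sigma> * cartan n i j)) (act (X \<sigma> j r') (act (X \<sigma> i (r + 1)) v))
        = fscale (e powi (sg \<sigma> * cartan n i j)) (act (X \<sigma> i r) (act (X \<sigma> j (r' + 1)) v))
          - act (X \<sigma> j (r' + 1)) (act (X \<sigma> i r) v)" (is "?L = ?R")
    proof
      fix b
      consider "b \<notin> B" | "b \<in> B" "i = j" | "b \<in> B" "i \<noteq> j" "adj n i j" | "b \<in> B" "i \<noteq> j" "\<not> adj n i j" by blast
      then show "?L b = ?R b"
      proof cases
        case 1
        then show ?thesis by (simp add: act_out fscale_def)
      next
        case 2
        then show ?thesis using ij sg_cases(3)[of \<sigma>] by (simp add: act_X_same fscale_def)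
      next
        case 3
        then have a: "adj n j i" "cartan n i j = -1" using ij adj_sym by (auto simp: cartan_adj)
        have step: "x powi (k + 1) * (x * e powi sg \<sigma>) powi k'
            = e powi (- sg \<sigma>) * (x powi k * (x * e powi sg \<sigma>) powi (k' + 1))" if "x \<noteq> 0" for x k k'
          using that e_nz by (simp add: power_int_add power_int_minus)
        show ?thesis
          using 3 ij a step[OF u_nz[of b i], of r r'] step[OF u_nz[of b j], of r' r] sg_cases(3)[of \<sigma>]
          by (auto simp: act_X_adj fscale_def)
      next
        case 4
        then show ?thesis using ij act_X_far_commute[of b i j]
          by (simp add: fscale_def cartan_adj act_X_far) 
      qed
    qed
  next
    fix i j v \<sigma> r1 r2 r' assume i: "i \<le> n" and j: "j = nxt n i \<or> j = prv n i"
    have a: "adj n i j" using j by (simp add: adj_def)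
    have jn: "j \<le> n" using j nxt_le prv_le by auto
    have a': "adj n j i" using a adj_sym i jn by blast
    have twice: "act (X \<sigma> i a) (act (X \<sigma> i a') w) = 0" for a a' w
    proof
      fix b
      show "act (X \<sigma> i a) (act (X \<sigma> i a') w) b = 0 b"
        using i sg_cases(3)[of \<sigma>] by (cases "b \<in> B") (auto simp: act_X_same act_out)
    qed
    \<comment> \<open>A flip turns the sign at \<open>i\<close> from $\sigma$ to $-\sigma$, one at \<open>j\<close> then to 0, so \<open>i\<close> cannot be flipped again.\<close>
    have between: "act (X \<sigma> i a) (act (X \<sigma> j a') (act (X \<sigma> i a'') w)) = 0" for a a' a'' w
    proof
      fix b
      show "act (X \<sigma> i a) (act (X \<sigma> j a') (act (X \<sigma> i a'') w)) b = 0 b"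
      proof (cases "b \<in> B \<and> st b i = sg \<sigma>")
        case False
        then show ?thesis using i by (cases "b \<in> B") (auto simp: act_X act_out)
      next
        case True
        then have nz: "st b i \<noteq> 0" using sg_cases(3) by simp
        have "flip i b \<in> B" "st (flip i b) i \<noteq> 0" using True nz i flip_closed st_flip by auto
        then have "act (X \<sigma> j a') (act (X \<sigma> i a'') w) (flip i b) = 0"
          using i jn a' by (subst act_X_adj) auto
        then show ?thesis using True by (simp add: act_X[of b])
      qed
    qed
    have zero: "act (X \<sigma> k a) 0 = 0" for k a
      by (rule ext) (simp add: act_def)
    show "(act (X \<sigma> i r1) (act (X \<sigma> i r2) (act (X \<sigma> j r') v))
          - fscale (e + inverse e) (act (X \<sigma> i r1) (act (X \<sigma> j r') (act (X \<sigma> i r2) v)))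
          + act (X \<sigma> j r') (act (X \<sigma> i r1) (act (X \<sigma> i r2) v)))
        + (act (X \<sigma> i r2) (act (X \<sigma> i r1) (act (X \<sigma> j r') v))
          - fscale (e + inverse e) (act (X \<sigma> i r2) (act (X \<sigma> j r') (act (X \<sigma> i r1) v)))
          + act (X \<sigma> j r') (act (X \<sigma> i r2) (act (X \<sigma> i r1) v))) = 0"
      by (simp only: twice between zero) (simp add: fscale_def fun_eq_iff)
  next
    fix i j v \<sigma> r1 r2
    assume "i \<le> n" "j \<le> n" "j \<noteq> i" "j \<noteq> nxt n i" "j \<noteq> prv n i"
    then show "act (X \<sigma> i r1) (act (X \<sigma> j r2) v) = act (X \<sigma> j r2) (act (X \<sigma> i r1) v)"
      by (intro ext) (metis act_out act_X_far_commute adj_def)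
  qed
qed

end

section \<open>Basis, dimension and irreducibility\<close>

definition delta :: "rmonomial \<Rightarrow> rmonomial \<Rightarrow> complex" where
  "delta b = (\<lambda>c. if c = b then 1 else 0)"

lemma inj_delta: "inj delta"
  by (rule injI) (metis delta_def zero_neq_one)

context flip_system
begin

lemma delta_in_V: "b \<in> B \<Longrightarrow> delta b \<in> V"
  by (auto simp: delta_def V_def)

lemma delta_expansion: "f \<in> V \<Longrightarrow> f = (\<Sum>b\<in>B. fscale (f b) (delta b))"
  using finite_B by (intro ext) (auto simp: fun_sum_apply fscale_def delta_def V_def if_distrib cong: if_cong)

lemma independent_delta: "\<not> module.dependent fscale (delta ` B)"
proof -
  interpret vector_space fscale by (rule vector_space_fscale)
  show ?thesis
  proof (rule independent_if_scalars_zero)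
    show "finite (delta ` B)" using finite_B by simp
  next
    fix f x assume 0: "(\<Sum>x\<in>delta ` B. fscale (f x) x) = 0" and "x \<in> delta ` B"
    then obtain b where b: "b \<in> B" "x = delta b" by blast
    have "(\<Sum>x\<in>delta ` B. fscale (f x) x) = (\<Sum>c\<in>B. fscale (f (delta c)) (delta c))"
      by (subst sum.reindex) (auto intro: inj_on_subset[OF inj_delta])
    then have "(\<Sum>c\<in>B. fscale (f (delta c)) (delta c)) b = 0"
      using 0 by simp
    then have "(\<Sum>c\<in>B. fscale (f (delta c)) (delta c) b) = 0"
      by (simp only: fun_sum_apply)
    then show "f x = 0"
      using b finite_B by (simp add: fscale_def delta_def if_distrib cong: if_cong)
  qed
qed

lemma span_delta: "module.span fscale (delta ` B) = V"
proof -
  interpret vector_space fscale by (rule vector_space_fscale)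
  have "subspace V" by (simp add: subspace_def V_def fscale_def)
  then have "span (delta ` B) \<subseteq> V" using delta_in_V by (intro span_minimal) auto
  moreover have "V \<subseteq> span (delta ` B)"
  proof
    fix f assume "f \<in> V"
    then have "f = (\<Sum>b\<in>B. fscale (f b) (delta b))" by (rule delta_expansion)
    also have "\<dots> \<in> span (delta ` B)"
      by (intro span_sum span_scale span_base imageI)
    finally show "f \<in> span (delta ` B)" .
  qed
  ultimately show ?thesis by blast
qed

lemma basis_delta: "indexed_basis fscale V B delta"
  using independent_delta span_delta inj_on_subset[OF inj_delta] by (simp add: indexed_basis_def)

lemma dim_V: "vector_space.dim fscale V = card B"
proof -
  interpret vector_space fscale by (rule vector_space_fscale)
  have "dim V = card (delta ` B)"
    using independent_delta span_delta by (metis dim_eq_card_independent dim_span)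
  then show ?thesis by (simp add: card_image inj_on_subset[OF inj_delta])
qed

lemma act_X_delta:
  assumes "b \<in> B" "i \<le> n"
  shows "act (X \<sigma> i a) (delta b)
    = (if st b i = - sg \<sigma> then fscale (u b i powi a) (delta (flip i b)) else 0)"
proof
  fix c
  show "act (X \<sigma> i a) (delta b) c
    = (if st b i = - sg \<sigma> then fscale (u b i powi a) (delta (flip i b)) else 0) c"
  proof (cases "c \<in> B \<and> st c i = sg \<sigma> \<and> flip i c = b")
    case True
    then have "st c i \<noteq> 0" using sg_cases(3) by simp
    then have "st b i = - sg \<sigma>" "u b i = u c i" "flip i b = c"
      using True assms flip_flip st_flip u_flip by auto
    then show ?thesis using True by (simp add: act_def delta_def fscale_def)
  next
    case False
    have "\<not> (st b i = - sg \<sigma> \<and> c = flip i b)"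
    proof
      assume *: "st b i = - sg \<sigma> \<and> c = flip i b"
      then have "st b i \<noteq> 0" using sg_cases(3)[of \<sigma>] by simp
      then show False using False * assms flip_closed flip_flip st_flip by simp
    qed
    then show ?thesis using False by (auto simp: act_def delta_def fscale_def)
  qed
qed

lemma act_K_delta: "b \<in> B \<Longrightarrow> act (K \<sigma> i) (delta b) = fscale (e powi (sg \<sigma> * st b i)) (delta b)"
  by (rule ext) (simp add: act_def delta_def fscale_def)

lemma phi_gen_delta:
  "b \<in> B \<Longrightarrow> i \<le> n \<Longrightarrow>
    phi_gen fscale e act \<sigma> i m (delta b) = fscale (phi_eig \<sigma> b i m) (delta b)"
  by (rule ext) (simp add: phi_gen_act delta_def fscale_def)

text \<open>Either some $k_i$ separates the two states, or they have the same non-neutral nodes and differ in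
  \<open>u\<close> at one of them, where the eigenvalue of $h_{i,1}$ is \<open>u b i\<close> times a non-zero constant depending
  only on \<open>st b i\<close>.\<close>

lemma separating_generator:
  assumes "b \<in> B" "b' \<in> B" "b \<noteq> b'"
  obtains g d where "g \<in> generators n" "\<And>f c. c \<in> B \<Longrightarrow> act g f c = d c * f c" "d b \<noteq> (d b' :: complex)"
proof -
  obtain i where i: "i \<le> n" and "st b i \<noteq> st b' i \<or> st b i = st b' i \<and> st b i \<noteq> 0 \<and> u b i \<noteq> u b' i"
    using separated assms by blast
  then consider "st b i \<noteq> st b' i" | "st b i = st b' i" "st b i \<noteq> 0" "u b i \<noteq> u b' i" by blast
  then show thesis
  proof cases
    case 1
    have "e powi s \<noteq> e powi s'" if "s \<in> {-1, 0, 1}" "s' \<in> {-1, 0, 1}" "s \<noteq> s'" for s s' :: int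
      using that e_nz e_sq by (auto simp: power_int_minus field_simps power2_eq_square)
    then have "e powi st b i \<noteq> e powi st b' i" using 1 st_range i assms by metis
    then show thesis
      using i by (intro that[of "K Plus i" "\<lambda>c. e powi st c i"])
        (auto simp: act_K sg_def generators_def cartan_generators_def)
  next
    case 2
    have s: "st b i \<in> {-1, 1}" using 2 st_range[of b i] i assms by auto
    have "1 - e powi (- 2 * st b i) \<noteq> 0"
      using s e_sq by (auto simp: power_int_minus)
    moreover have "h_eig c i 1 = u c i * (1 - e powi (- 2 * st c i)) / (e - inverse e)" for c
      by (simp add: h_eig_def algebra_simps)
    ultimately have "h_eig b i 1 \<noteq> h_eig b' i 1" using 2 e_diff_nz by simp
    then show thesis
      using i by (intro that[of "H i 1" "\<lambda>c. h_eig c i 1"])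
        (auto simp: act_H generators_def cartan_generators_def)
  qed
qed

text \<open>If the support of \<open>w\<close> contains a second state \<open>b'\<close>, a generator with different eigenvalues on \<open>b\<close>
  and \<open>b'\<close>, minus its eigenvalue on \<open>b'\<close>, removes \<open>b'\<close> from the support and keeps \<open>b\<close>.\<close>

lemma delta_in_submodule:
  assumes W: "toroidal_module.submodule fscale n V act W" and w: "w \<in> W" and b: "w b \<noteq> 0"
  shows "delta b \<in> W"
proof -
  interpret toroidal_module fscale n e V act by (rule toroidal_module_act)
  have sub: "subspace W" and WV: "W \<subseteq> V" and closed: "\<And>g w. g \<in> generators n \<Longrightarrow> w \<in> W \<Longrightarrow> act g w \<in> W"
    using W by (auto simp: submodule_def)
  from w b show ?thesis
  proof (induction "card {c. w c \<noteq> 0}" arbitrary: w rule: less_induct)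
    case less
    have supp: "{c. w c \<noteq> 0} \<subseteq> B" using less.prems WV by (auto simp: V_def)
    show ?case
    proof (cases "\<exists>b'. b' \<noteq> b \<and> w b' \<noteq> 0")
      case False
      then have "delta b = fscale (1 / w b) w"
        using less.prems by (intro ext) (auto simp: delta_def fscale_def)
      then show ?thesis using sub less.prems by (simp add: subspace_scale)
    next
      case True
      then obtain b' where b': "b' \<noteq> b" "w b' \<noteq> 0" by blast
      have B: "b \<in> B" "b' \<in> B" using supp less.prems b' by auto
      from separating_generator[OF B] b' obtain g d
        where g: "g \<in> generators n" "\<And>f c. c \<in> B \<Longrightarrow> act g f c = d c * f c" "d b \<noteq> d b'" by metis
      define w' where "w' = act g w - fscale (d b') w"
      have w': "w' c = (d c - d b') * w c" for c
      proof (cases "c \<in> B")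
        case True
        then show ?thesis by (simp add: w'_def fscale_def g algebra_simps)
      next
        case False
        then have "w c = 0" using supp by auto
        then show ?thesis using False by (simp add: w'_def fscale_def act_out)
      qed
      have "w' \<in> W"
        unfolding w'_def using sub closed g less.prems by (intro subspace_diff subspace_scale) auto
      moreover have "w' b \<noteq> 0" using w' g less.prems by simp
      moreover have "card {c. w' c \<noteq> 0} < card {c. w c \<noteq> 0}"
      proof (rule psubset_card_mono)
        show "finite {c. w c \<noteq> 0}" using supp finite_B finite_subset by blast
        show "{c. w' c \<noteq> 0} \<subset> {c. w c \<noteq> 0}" using b' w' by auto
      qed
      ultimately show ?thesis using less.hyps by blast
    qed
  qed
qed

lemma irreducible_act: "toroidal_module.irreducible_module fscale n V act"
proof -
  interpret toroidal_module fscale n e V act by (rule toroidal_module_act)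
  obtain b0 where b0: "b0 \<in> B" using B_nonempty by blast
  have "delta b0 \<noteq> 0" by (metis delta_def zero_fun_apply zero_neq_one)
  then have "V \<noteq> {0}" using delta_in_V b0 by blast
  moreover have "W = V" if W: "submodule W" and "W \<noteq> {0}" for W
  proof -
    have sub: "subspace W" and WV: "W \<subseteq> V" and closed: "\<And>g w. g \<in> generators n \<Longrightarrow> w \<in> W \<Longrightarrow> act g w \<in> W"
      using W by (auto simp: submodule_def)
    obtain w where "w \<in> W" "w \<noteq> 0" using \<open>W \<noteq> {0}\<close> sub subspace_0 by blast
    then obtain b where b: "w b \<noteq> 0" by (auto simp: fun_eq_iff)
    then have bB: "b \<in> B" using \<open>w \<in> W\<close> WV by (auto simp: V_def)
    have start: "delta b \<in> W" using W \<open>w \<in> W\<close> b delta_in_submodule by blast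
    have "delta c \<in> W" if "c \<in> B" for c
      using connected[OF bB that]
    proof (induction rule: rtrancl_induct)
      case base
      then show ?case by (rule start)
    next
      case (step c c')
      then obtain i where i: "c \<in> B" "i \<le> n" "st c i \<noteq> 0" "c' = flip i c" by auto
      obtain \<sigma> where \<sigma>: "st c i = - sg \<sigma>"
      proof -
        have "st c i = - sg Plus \<or> st c i = - sg Minus"
          using st_range[of c i] i by (auto simp: sg_def)
        then show thesis using that by blast
      qed
      have "act (X \<sigma> i 0) (delta c) \<in> W"
        using closed step i by (auto simp: generators_def)
      also have "act (X \<sigma> i 0) (delta c) = delta c'"
        using i \<sigma> by (simp add: act_X_delta fscale_def)
      finally show ?case .
    qed
    then have "span (delta ` B) \<subseteq> W" using sub by (intro span_minimal) auto
    then show "W = V" using span_delta WV by auto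
  qed
  ultimately show ?thesis unfolding irreducible_module_def by blast
qed

end

section \<open>Comparison with the q-character\<close>

lemma ratio_inverse:
  "inverse ((1 - fps_const \<alpha> * fps_X) / (1 - fps_const \<beta> * fps_X))
    = (1 - fps_const \<beta> * fps_X) / (1 - fps_const \<alpha> * fps_X :: complex fps)"
proof -
  have u: "fps_nth (1 - fps_const c * fps_X :: complex fps) 0 \<noteq> 0" for c by simp
  show ?thesis
    by (simp add: fps_divide_unit u fps_inverse_mult fps_inverse_idempotent mult.commute)
qed

text \<open>In the expansion at infinity, $(X - a)/(X - b) = (a/b)\,(1 - a^{-1}X)/(1 - b^{-1}X)$; the constant
  \<open>a/b\<close> is $\epsilon^{-2}$ and turns the factor $\epsilon$ into $\epsilon^{-1}$.\<close>

lemma Y_eigenvalue_ratio: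
  assumes "e \<noteq> 0"
  shows "Y_eigenvalue e \<sigma> l = fps_const (e powi sg \<sigma>)
    * ((1 - fps_const (e powi (sg \<sigma> * (l - 1))) * fps_X) / (1 - fps_const (e powi (sg \<sigma> * (l + 1))) * fps_X))"
proof (cases \<sigma>)
  case Plus
  then show ?thesis by (simp add: Y_eigenvalue_def sg_def)
next
  case Minus
  have flip: "fps_X - fps_const c = fps_const (- c) * (1 - fps_const (inverse c) * fps_X)" if "c \<noteq> 0" for c :: complex
    using that by (simp add: right_diff_distrib mult.assoc[symmetric] fps_const_neg[symmetric] del: fps_const_neg)
  let ?a = "e powi (l - 1)" and ?b = "e powi (l + 1)"
  have ab: "?a \<noteq> 0" "?b \<noteq> 0" using assms by simp_all
  have c: "e * (?a * inverse ?b) = inverse e"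
    using assms by (simp add: power_int_add power_int_diff field_simps)
  have "fps_const e * ((fps_X - fps_const ?a) / (fps_X - fps_const ?b))
    = fps_const (e * (?a * inverse ?b)) *
       ((1 - fps_const (inverse ?a) * fps_X) * inverse (1 - fps_const (inverse ?b) * fps_X))"
    unfolding flip[OF ab(1)] flip[OF ab(2)]
    using ab by (subst fps_divide_unit)
      (simp_all add: fps_inverse_mult fps_const_inverse mult_ac)
  also have "\<dots> = fps_const (inverse e) *
       ((1 - fps_const (inverse ?a) * fps_X) / (1 - fps_const (inverse ?b) * fps_X))"
    unfolding c by (subst fps_divide_unit) simp_all
  finally show ?thesis using Minus by (simp add: Y_eigenvalue_def sg_def flip: power_int_minus)
qed

lemma Y_eigenvalue_powi:
  assumes "e \<noteq> 0" "s \<in> {-1, 1}"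
  shows "Y_eigenvalue e \<sigma> l powi s = fps_const (e powi (sg \<sigma> * s))
    * (fps_exp 1 oo log_ratio (e powi (sg \<sigma> * (l + s))) (e powi (sg \<sigma> * (l - s))))"
proof (cases "s = 1")
  case True
  then show ?thesis using assms by (simp add: Y_eigenvalue_ratio exp_log_ratio)
next
  case False
  then have "s = -1" using assms by simp
  then show ?thesis using assms
    by (simp add: Y_eigenvalue_ratio exp_log_ratio power_int_minus fps_inverse_mult ratio_inverse
        fps_const_inverse del: div_diff)
qed

lemma (in flip_system) eigenvalue_series_single:
  assumes "b \<in> B" "i \<le> n" "0 \<le> l" "l < int N" "b i = (\<lambda>c. if c = l then st b i else 0)"
    and u: "st b i \<noteq> 0 \<Longrightarrow> u b i = e powi (l + st b i)"
  shows "fps_nth (eigenvalue_series e N \<sigma> b i) t = phi_eig \<sigma> b i (sg \<sigma> * int t)"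
proof -
  have "eigenvalue_series e N \<sigma> b i = (\<Prod>c\<in>{0..<int N}. if c = l then Y_eigenvalue e \<sigma> l powi st b i else 1)"
    unfolding eigenvalue_series_def using assms(5) by (intro prod.cong) (auto simp: fun_eq_iff)
  also have "\<dots> = Y_eigenvalue e \<sigma> l powi st b i"
    using assms by simp
  finally have *: "eigenvalue_series e N \<sigma> b i = Y_eigenvalue e \<sigma> l powi st b i" .
  show ?thesis
  proof (cases "st b i = 0")
    case True
    then show ?thesis using sg_cases(3)[of \<sigma>] by (auto simp: * phi_eig_def zero_less_mult_iff mult_less_0_iff sg_def split: sign.splits)
  next
    case False
    then have s: "st b i \<in> {-1, 1}" using st_range assms by blast
    have "u b i * e powi (- 2 * st b i) = e powi (l - st b i)"
      using u False e_nz by (simp add: algebra_simps flip: power_int_add)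
    then show ?thesis unfolding phi_eig_nth[OF assms(1,2)] * Y_eigenvalue_powi[OF e_nz s]
      using u False by (simp add: mult.commute flip: power_int_mult)
  qed
qed

section \<open>Thin monomials\<close>

lemma primitive_root_powi_eq_iff:
  assumes "primitive_root_of_unity N e"
  shows "e powi a = e powi b \<longleftrightarrow> a mod int N = b mod int N"
proof -
  have N: "N > 0" and eN: "e ^ N = 1" and prim: "\<And>k. 0 < k \<Longrightarrow> k < N \<Longrightarrow> e ^ k \<noteq> 1"
    using assms by (auto simp: primitive_root_of_unity_def)
  have e0: "e \<noteq> 0" using eN N by (auto simp: power_0_left)
  have red: "e powi c = e ^ nat (c mod int N)" for c
  proof -
    have "e powi (int N * (c div int N)) = 1"
      using eN by (simp add: power_int_mult)
    moreover have "e powi c = e powi (int N * (c div int N)) * e powi (c mod int N)"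
      using e0 by (simp flip: power_int_add)
    ultimately show ?thesis using N by (simp add: power_int_def)
  qed
  have one: "e powi c = 1 \<longleftrightarrow> c mod int N = 0" for c
  proof
    assume *: "e powi c = 1"
    have "nat (c mod int N) < N" using N by (simp add: nat_less_iff)
    then have "\<not> 0 < nat (c mod int N)" using * prim red by metis
    then show "c mod int N = 0" using N pos_mod_sign[of "int N" c] by linarith
  qed (simp add: red)
  have "e powi a = e powi b \<longleftrightarrow> e powi (a - b) = 1"
    using e0 by (simp add: power_int_diff)
  also have "\<dots> \<longleftrightarrow> a mod int N = b mod int N"
    by (simp add: one mod_eq_dvd_iff mod_eq_0_iff_dvd)
  finally show ?thesis .
qed

definition single :: "int \<Rightarrow> int \<Rightarrow> int \<Rightarrow> int" where
  "single h c = (\<lambda>l. if l = h then c else 0)"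

text \<open>For an exponent function supported at a single place the partial sums are step functions with
  values 0 and \<open>c\<close>, so that at most one of the two Kashiwara operators is non-zero.\<close>

lemma phi_eps_single:
  assumes m: "expo m i = single h c" and c: "c \<in> {-1, 0, 1}"
  shows "phi m i = max 0 c" and "eps m i = max 0 (- c)"
    and "c = 1 \<Longrightarrow> q_ind m i = h" and "c = -1 \<Longrightarrow> p_ind m i = h"
proof -
  have "{l. l \<le> a \<and> expo m i l \<noteq> 0} = (if h \<le> a \<and> c \<noteq> 0 then {h} else {})" for a
    by (auto simp: m single_def)
  then have up: "phi_upto m i = (\<lambda>a. if h \<le> a then c else 0)"
    by (auto simp: phi_upto_def fun_eq_iff) (simp add: m single_def)
  have "{l. l \<ge> a \<and> expo m i l \<noteq> 0} = (if a \<le> h \<and> c \<noteq> 0 then {h} else {})" for a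
    by (auto simp: m single_def)
  then have down: "eps_from m i = (\<lambda>a. if a \<le> h then - c else 0)"
    by (auto simp: eps_from_def fun_eq_iff) (simp add: m single_def)
  have "phi_upto m i h = c" "phi_upto m i (h - 1) = 0" by (simp_all add: up)
  then have "{0, c} \<subseteq> range (phi_upto m i)" by (metis empty_subsetI insert_subset rangeI)
  moreover have "range (phi_upto m i) \<subseteq> {0, c}" by (auto simp: up)
  ultimately have "range (phi_upto m i) = {0, c}" by blast
  then show phi: "phi m i = max 0 c" by (simp add: phi_def)
  have "eps_from m i h = - c" "eps_from m i (h + 1) = 0" by (simp_all add: down)
  then have "{0, - c} \<subseteq> range (eps_from m i)" by (metis empty_subsetI insert_subset rangeI)
  moreover have "range (eps_from m i) \<subseteq> {0, - c}" by (auto simp: down)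
  ultimately have "range (eps_from m i) = {0, - c}" by blast
  then show eps: "eps m i = max 0 (- c)" by (simp add: eps_def)
  show "q_ind m i = h" if "c = 1"
    unfolding q_ind_def phi up using that by (intro Least_equality) (auto split: if_splits)
  show "p_ind m i = h" if "c = -1"
    unfolding p_ind_def eps down using that by (intro Greatest_equality) (auto split: if_splits)
qed

text \<open>For $n \ge 2$ the two neighbours are distinct, so that each contributes a single factor.\<close>

lemma expo_mA:
  assumes "i \<le> n" "n \<ge> 2"
  shows "expo (mA n i c) j l = (if j = i then single (c - 1) 1 l + single (c + 1) 1 l else 0)
    - (if adj n i j then single c 1 l else 0)"
  using assms nxt_neq_prv[of n i] adj_irrefl[of n i]
  by (auto simp: mA_def mexp_def mtimes_def minv_def mY_def single_def adj_def)

lemma e_f_op_single: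
  assumes "expo m i = single h c" "c \<in> {-1, 0, 1}"
  shows "f_op n i m = (if c = 1 then Some (m \<odot> minv (mA n i (h + 1))) else None)"
    and "e_op n i m = (if c = -1 then Some (m \<odot> mA n i (h - 1)) else None)"
  using phi_eps_single[OF assms] assms by (auto simp: f_op_def e_op_def)

text \<open>A parametrisation of a crystal of thin monomials: the monomial of parameter \<open>x\<close> is the product of
  the factors $Y_{i,h}^{\sigma}$ with \<open>h = ht x i\<close> and $\sigma$ \<open>= sn x i\<close>, and \<open>mv i x\<close> is the parameter of its
  flip at \<open>i\<close>. Heights carry information only where the sign is non-zero, and the axioms constrain
  them only there. Weights are left out: neither the effect of the Kashiwara
  operators on exponents nor the reduction depends on them.\<close>

locale thin_family =
  fixes n :: nat and S :: "'x set" and sn ht :: "'x \<Rightarrow> nat \<Rightarrow> int" and mv :: "nat \<Rightarrow> 'x \<Rightarrow> 'x"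
    and x0 :: 'x
  assumes n_ge_2: "n \<ge> 2"
    and sn_range: "x \<in> S \<Longrightarrow> i \<le> n \<Longrightarrow> sn x i \<in> {-1, 0, 1}"
    and mv_closed: "x \<in> S \<Longrightarrow> i \<le> n \<Longrightarrow> sn x i \<noteq> 0 \<Longrightarrow> mv i x \<in> S"
    and sn_mv: "x \<in> S \<Longrightarrow> i \<le> n \<Longrightarrow> sn x i \<noteq> 0 \<Longrightarrow> sn (mv i x) i = - sn x i"
    and ht_mv: "x \<in> S \<Longrightarrow> i \<le> n \<Longrightarrow> sn x i \<noteq> 0 \<Longrightarrow> ht (mv i x) i = ht x i + 2 * sn x i"
    and sn_mv_adj: "x \<in> S \<Longrightarrow> i \<le> n \<Longrightarrow> sn x i \<noteq> 0 \<Longrightarrow> j \<le> n \<Longrightarrow> adj n i j \<Longrightarrow>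
        sn (mv i x) j = sn x j + sn x i"
    and ht_mv_adj: "x \<in> S \<Longrightarrow> i \<le> n \<Longrightarrow> sn x i \<noteq> 0 \<Longrightarrow> j \<le> n \<Longrightarrow> adj n i j \<Longrightarrow> sn x j = 0 \<Longrightarrow>
        ht (mv i x) j = ht x i + sn x i"
    and ht_adj: "x \<in> S \<Longrightarrow> i \<le> n \<Longrightarrow> sn x i \<noteq> 0 \<Longrightarrow> j \<le> n \<Longrightarrow> adj n i j \<Longrightarrow> sn x j \<noteq> 0 \<Longrightarrow>
        ht x j = ht x i + sn x i"
    and sn_mv_far: "x \<in> S \<Longrightarrow> i \<le> n \<Longrightarrow> sn x i \<noteq> 0 \<Longrightarrow> j \<le> n \<Longrightarrow> j \<noteq> i \<Longrightarrow> \<not> adj n i j \<Longrightarrow>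
        sn (mv i x) j = sn x j"
    and ht_mv_far: "x \<in> S \<Longrightarrow> i \<le> n \<Longrightarrow> sn x i \<noteq> 0 \<Longrightarrow> j \<le> n \<Longrightarrow> j \<noteq> i \<Longrightarrow> \<not> adj n i j \<Longrightarrow>
        sn x j \<noteq> 0 \<Longrightarrow> ht (mv i x) j = ht x j"
    and x0_in: "x0 \<in> S"
    and reachable: "x \<in> S \<Longrightarrow> (x0, x) \<in> {(y, mv i y) | y i. y \<in> S \<and> i \<le> n \<and> sn y i \<noteq> 0}\<^sup>*"
begin

definition shape :: "'x \<Rightarrow> nat \<Rightarrow> int \<Rightarrow> int" where
  "shape x i = (if i \<le> n then single (ht x i) (sn x i) else (\<lambda>l. 0))"

text \<open>The axioms say exactly that the flip at \<open>i\<close> is the multiplication by $A_{i,h+\sigma}^{-\sigma}$.\<close>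

lemma shape_mv:
  assumes x: "x \<in> S" and i: "i \<le> n" and nz: "sn x i \<noteq> 0"
  shows "shape (mv i x) j l = shape x j l - sn x i * expo (mA n i (ht x i + sn x i)) j l"
proof (cases "j \<le> n")
  case False
  then have "j \<noteq> i" "\<not> adj n i j" using i by (auto simp: adj_def nxt_le prv_le)
  then show ?thesis using False i n_ge_2 by (simp add: shape_def expo_mA)
next
  case True
  consider "j = i" | "j \<noteq> i" "adj n i j" "sn x j = 0" | "j \<noteq> i" "adj n i j" "sn x j \<noteq> 0" | "j \<noteq> i" "\<not> adj n i j" by blast
  then show ?thesis
  proof cases
    case 1
    have "sn x i = 1 \<or> sn x i = -1" using sn_range[OF x i] nz by auto
    then show ?thesis using 1 x i nz n_ge_2 adj_irrefl[of n i]
      by (auto simp: shape_def expo_mA sn_mv ht_mv single_def)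
  next
    case 2
    then show ?thesis using True x i nz n_ge_2
      by (simp add: shape_def expo_mA sn_mv_adj ht_mv_adj single_def)
  next
    case 3
    have "sn x j + sn x i \<in> {-1, 0, 1}"
      using sn_range[OF mv_closed[OF x i nz] True] sn_mv_adj[OF x i nz True 3(2)] by simp
    then have "sn x j = - sn x i" using sn_range[OF x i] sn_range[OF x True] nz 3 by auto
    then show ?thesis using 3 True x i nz n_ge_2
      by (simp add: shape_def expo_mA sn_mv_adj ht_adj[OF x i nz True] single_def)
  next
    case 4
    then show ?thesis using True x i nz n_ge_2 ht_mv_far[OF x i nz True]
      by (cases "sn x j = 0") (simp_all add: shape_def expo_mA sn_mv_far single_def)
  qed
qed

lemma step_single:
  assumes x: "x \<in> S" and i: "i \<le> n" and m: "expo m = shape x"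
  shows "sn x i = 1 \<Longrightarrow> \<exists>m'. f_op n i m = Some m' \<and> expo m' = shape (mv i x)"
    and "sn x i = -1 \<Longrightarrow> \<exists>m'. e_op n i m = Some m' \<and> expo m' = shape (mv i x)"
    and "sn x i \<noteq> 1 \<Longrightarrow> f_op n i m = None"
    and "sn x i \<noteq> -1 \<Longrightarrow> e_op n i m = None"
proof -
  have s: "expo m i = single (ht x i) (sn x i)" using m i by (simp add: shape_def)
  note op = e_f_op_single[OF s sn_range[OF x i], of n]
  show "\<exists>m'. f_op n i m = Some m' \<and> expo m' = shape (mv i x)" if "sn x i = 1"
    using that op shape_mv[OF x i] m by (auto simp: fun_eq_iff mtimes_def minv_def)
  show "\<exists>m'. e_op n i m = Some m' \<and> expo m' = shape (mv i x)" if "sn x i = -1"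
    using that op shape_mv[OF x i] m by (auto simp: fun_eq_iff mtimes_def minv_def)
  show "sn x i \<noteq> 1 \<Longrightarrow> f_op n i m = None" and "sn x i \<noteq> -1 \<Longrightarrow> e_op n i m = None"
    using op by simp_all
qed

lemma subcrystal_shape:
  assumes "expo m0 = shape x0" and "m \<in> subcrystal n s m0"
  shows "\<exists>x\<in>S. expo m = shape x"
  using assms(2)
proof induction
  case base
  then show ?case using assms(1) x0_in by blast
next
  case (raise m i m')
  then obtain x where x: "x \<in> S" "expo m = shape x" by blast
  with raise step_single(2,4)[OF x(1) \<open>i \<le> n\<close> x(2)] mv_closed[OF x(1) \<open>i \<le> n\<close>]
  show ?case by (cases "sn x i = -1") auto
next
  case (lower m i m')
  then obtain x where x: "x \<in> S" "expo m = shape x" by blast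
  with lower step_single(1,3)[OF x(1) \<open>i \<le> n\<close> x(2)] mv_closed[OF x(1) \<open>i \<le> n\<close>]
  show ?case by (cases "sn x i = 1") auto
qed

lemma shape_in_subcrystal:
  assumes m0: "expo m0 = shape x0" "m0 \<in> monomial_group n s" and "x \<in> S"
  shows "\<exists>m\<in>subcrystal n s m0. expo m = shape x"
  using reachable[OF \<open>x \<in> S\<close>]
proof (induction rule: rtrancl_induct)
  case base
  then show ?case using m0 subcrystal.base by blast
next
  case (step y z)
  then obtain i m where i: "y \<in> S" "i \<le> n" "sn y i \<noteq> 0" "z = mv i y"
    and m: "m \<in> subcrystal n s m0" "expo m = shape y" by auto
  have "sn y i = 1 \<or> sn y i = -1" using sn_range[OF i(1,2)] i(3) by auto
  then show ?case
    using step_single(1,2)[OF i(1,2) m(2)] m i subcrystal.raise subcrystal.lower by metis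
qed

end

section \<open>Reduction at a root of unity\<close>

locale thin_family_root = thin_family n S sn ht mv x0
  for n :: nat and S :: "'x set" and sn ht :: "'x \<Rightarrow> nat \<Rightarrow> int" and mv :: "nat \<Rightarrow> 'x \<Rightarrow> 'x"
    and x0 :: 'x +
  fixes N :: nat and e :: complex
  assumes N_ge: "N \<ge> 3" and root: "primitive_root_of_unity N e"
begin

definition rshape :: "'x \<Rightarrow> rmonomial" where
  "rshape x i = (if i \<le> n then single (ht x i mod int N) (sn x i) else (\<lambda>l. 0))"

text \<open>The data of a flip system are defined on reduced monomials directly, so that they
  depend on no choice of a lift. For an exponent function \<open>b i\<close> with a single entry $\sigma = \pm1$ at
  \<open>c\<close>, the sums below evaluate to $\sigma$ and to $c + \sigma$.\<close>

definition st :: "rmonomial \<Rightarrow> nat \<Rightarrow> int" where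
  "st b i = (\<Sum>c\<in>{0..<int N}. b i c)"

definition position :: "rmonomial \<Rightarrow> nat \<Rightarrow> int" where
  "position b i = (\<Sum>c\<in>{0..<int N}. c * \<bar>b i c\<bar>) + st b i"

definition u :: "rmonomial \<Rightarrow> nat \<Rightarrow> complex" where
  "u b i = e powi position b i"

text \<open>The exponents of the reduction of $A_{i,c}$.\<close>

definition reduced_A :: "nat \<Rightarrow> int \<Rightarrow> rmonomial" where
  "reduced_A i c j l = (if j = i then single ((c - 1) mod int N) 1 l + single ((c + 1) mod int N) 1 l else 0)
     - (if adj n i j then single (c mod int N) 1 l else 0)"

definition flip :: "nat \<Rightarrow> rmonomial \<Rightarrow> rmonomial" where
  "flip i b = (\<lambda>j l. b j l - st b i * reduced_A i (position b i) j l)"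

lemma N_pos: "int N > 0"
  using N_ge by simp

lemma reduce_shape: "expo m = shape x \<Longrightarrow> reduce N m = rshape x"
proof (intro ext)
  fix i c assume m: "expo m = shape x"
  show "reduce N m i c = rshape x i c"
  proof (cases "i \<le> n \<and> sn x i \<noteq> 0")
    case False
    then show ?thesis by (auto simp: reduce_def m shape_def rshape_def single_def)
  next
    case True
    then have "{l. l mod int N = c \<and> expo m i l \<noteq> 0} = (if ht x i mod int N = c then {ht x i} else {})"
      by (auto simp: m shape_def single_def)
    then show ?thesis using True N_pos by (auto simp: reduce_def rshape_def single_def m shape_def)
  qed
qed

lemma st_rshape: "i \<le> n \<Longrightarrow> st (rshape x) i = sn x i"
  using N_pos by (simp add: st_def rshape_def single_def)

lemma position_rshape: "i \<le> n \<Longrightarrow> position (rshape x) i = (ht x i mod int N) * \<bar>sn x i\<bar> + sn x i"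
  using N_pos by (simp add: position_def st_rshape) (simp add: rshape_def single_def if_distrib cong: if_cong)

lemma position_rshape_mod:
  assumes "x \<in> S" "i \<le> n" "sn x i \<noteq> 0"
  shows "position (rshape x) i mod int N = (ht x i + sn x i) mod int N"
proof -
  have "\<bar>sn x i\<bar> = 1" using sn_range[OF assms(1,2)] assms(3) by auto
  then show ?thesis using assms by (simp add: position_rshape mod_add_left_eq)
qed

lemma u_rshape:
  assumes "x \<in> S" "i \<le> n" "sn x i \<noteq> 0"
  shows "u (rshape x) i = e powi (ht x i + sn x i)"
  unfolding u_def primitive_root_powi_eq_iff[OF root] using position_rshape_mod[OF assms] .

lemma reduced_A_cong: "c mod int N = c' mod int N \<Longrightarrow> reduced_A i c = reduced_A i c'"
  unfolding reduced_A_def fun_eq_iff by (metis mod_add_left_eq mod_diff_left_eq)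

lemma flip_rshape:
  assumes x: "x \<in> S" and i: "i \<le> n" and nz: "sn x i \<noteq> 0"
  shows "flip i (rshape x) = rshape (mv i x)"
proof (intro ext)
  fix j l
  have reduced_A: "reduced_A i (position (rshape x) i) = reduced_A i (ht x i + sn x i)"
    by (rule reduced_A_cong) (rule position_rshape_mod[OF assms])
  have "flip i (rshape x) j l = rshape x j l - sn x i * reduced_A i (ht x i + sn x i) j l"
    using i by (simp add: flip_def reduced_A st_rshape)
  also have "\<dots> = rshape (mv i x) j l"
  proof (cases "j \<le> n")
    case False
    then have "j \<noteq> i" "\<not> adj n i j" using i by (auto simp: adj_def nxt_le prv_le)
    then show ?thesis using False by (simp add: rshape_def reduced_A_def)
  next
    case True
    consider "j = i" | "j \<noteq> i" "adj n i j" "sn x j = 0" | "j \<noteq> i" "adj n i j" "sn x j \<noteq> 0" | "j \<noteq> i" "\<not> adj n i j" by blast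
    then show ?thesis
    proof cases
      case 1
      have "sn x i = 1 \<or> sn x i = -1" using sn_range[OF x i] nz by auto
      then show ?thesis using 1 x i nz n_ge_2 adj_irrefl[of n i]
        by (auto simp: rshape_def reduced_A_def sn_mv ht_mv single_def add.commute)
    next
      case 2
      then show ?thesis using True x i nz
        by (simp add: rshape_def reduced_A_def sn_mv_adj ht_mv_adj single_def)
    next
      case 3
      have "sn x j + sn x i \<in> {-1, 0, 1}"
        using sn_range[OF mv_closed[OF x i nz] True] sn_mv_adj[OF x i nz True 3(2)] by simp
      then have "sn x j = - sn x i" using sn_range[OF x i] sn_range[OF x True] nz 3 by auto
      then show ?thesis using 3 True x i nz
        by (simp add: rshape_def reduced_A_def sn_mv_adj ht_adj[OF x i nz True] single_def)
    next
      case 4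
      then show ?thesis using True x i nz ht_mv_far[OF x i nz True]
        by (cases "sn x j = 0") (simp_all add: rshape_def reduced_A_def sn_mv_far single_def)
    qed
  qed
  finally show "flip i (rshape x) j l = rshape (mv i x) j l" .
qed

lemma flip_far: "j \<noteq> i \<Longrightarrow> \<not> adj n i j \<Longrightarrow> flip i b j = b j"
  by (simp add: flip_def reduced_A_def)

text \<open>A flip at \<open>i\<close> is a translation by a vector depending on the row \<open>b i\<close> only, and a flip at a
  distant node does not change this row.\<close>

lemma flip_far_commute:
  assumes "i \<le> n" "j \<le> n" "j \<noteq> i" "\<not> adj n i j"
  shows "flip j (flip i b) = flip i (flip j b)"
proof -
  have "\<not> adj n j i" using assms adj_sym by blast
  then have "st (flip j b) i = st b i" "position (flip j b) i = position b i"
    "st (flip i b) j = st b j" "position (flip i b) j = position b j"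
    using assms flip_far[of j i b] flip_far[of i j b] by (simp_all add: st_def position_def)
  then show ?thesis unfolding flip_def[of i "flip j b"] flip_def[of j "flip i b"]
    by (simp add: flip_def algebra_simps)
qed

lemma flip_flip_rshape:
  assumes x: "x \<in> S" and i: "i \<le> n" and nz: "sn x i \<noteq> 0"
  shows "flip i (flip i (rshape x)) = rshape x"
proof -
  let ?y = "mv i x"
  have y: "?y \<in> S" "sn ?y i \<noteq> 0" using mv_closed[OF assms] sn_mv[OF assms] nz by auto
  have "position (rshape ?y) i mod int N = position (rshape x) i mod int N"
    using position_rshape_mod[OF assms] position_rshape_mod[OF y(1) i y(2)] sn_mv[OF assms] ht_mv[OF assms]
    by (simp add: add.commute)
  then have "reduced_A i (position (rshape ?y) i) = reduced_A i (position (rshape x) i)" by (rule reduced_A_cong)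
  moreover have "st (rshape ?y) i = - st (rshape x) i"
    using i sn_mv[OF assms] by (simp add: st_rshape)
  ultimately have "flip i (rshape ?y) = (\<lambda>j l. rshape ?y j l + st (rshape x) i * reduced_A i (position (rshape x) i) j l)"
    by (simp add: flip_def)
  also have "\<dots> = rshape x"
    unfolding flip_rshape[OF assms, symmetric] by (simp add: flip_def)
  finally show ?thesis by (simp add: flip_rshape[OF assms])
qed

text \<open>Each row is one of finitely many functions, even when the parameter set is infinite.\<close>

lemma finite_rshape: "finite (rshape ` S)"
proof -
  have sub: "rshape x \<in> {b. (\<forall>i. (i \<in> {..n} \<longrightarrow> b i \<in> (\<lambda>(h, c). single h c) ` ({0..<int N} \<times> {-1, 0, 1}))
      \<and> (i \<notin> {..n} \<longrightarrow> b i = (\<lambda>l. 0)))}" if "x \<in> S" for x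
  proof -
    have "rshape x i \<in> (\<lambda>(h, c). single h c) ` ({0..<int N} \<times> {-1, 0, 1})" if "i \<le> n" for i
    proof (rule image_eqI)
      show "rshape x i = (\<lambda>(h, c). single h c) (ht x i mod int N, sn x i)"
        using that by (simp add: rshape_def)
      show "(ht x i mod int N, sn x i) \<in> {0..<int N} \<times> {-1, 0, 1}"
        using N_pos sn_range[OF \<open>x \<in> S\<close> that] by simp
    qed
    then show ?thesis by (auto simp: rshape_def)
  qed
  have "finite {b :: rmonomial. (\<forall>i. (i \<in> {..n} \<longrightarrow> b i \<in> (\<lambda>(h, c). single h c) ` ({0..<int N} \<times> {-1, 0, 1}))
      \<and> (i \<notin> {..n} \<longrightarrow> b i = (\<lambda>l. 0)))}"
    by (rule finite_set_of_finite_funs) auto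
  then show ?thesis using sub by (elim finite_subset[rotated]) blast
qed

lemma rshape_eqI:
  assumes x: "x \<in> S" and y: "y \<in> S" and s: "\<And>i. i \<le> n \<Longrightarrow> sn x i = sn y i"
    and u: "\<And>i. i \<le> n \<Longrightarrow> sn x i \<noteq> 0 \<Longrightarrow> u (rshape x) i = u (rshape y) i"
  shows "rshape x = rshape y"
proof
  fix i
  show "rshape x i = rshape y i"
  proof (cases "i \<le> n \<and> sn x i \<noteq> 0")
    case False
    then show ?thesis using s by (auto simp: rshape_def single_def)
  next
    case True
    then have "(ht x i + sn x i) mod int N = (ht y i + sn x i) mod int N"
      using u[of i] u_rshape[OF x, of i] u_rshape[OF y, of i] s[of i]
      by (simp add: primitive_root_powi_eq_iff[OF root])
    then have "ht x i mod int N = ht y i mod int N"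
      by (metis add_diff_cancel_right' mod_diff_left_eq)
    then show ?thesis using True s by (simp add: rshape_def)
  qed
qed

text \<open>Flips are involutions, so being reachable from \<open>x0\<close> makes any two states reachable from each
  other.\<close>

lemma rshape_connected:
  assumes "x \<in> S" "y \<in> S"
  shows "(rshape x, rshape y)
    \<in> {(c, flip i c) | c i. c \<in> rshape ` S \<and> i \<le> n \<and> st c i \<noteq> 0}\<^sup>*" (is "_ \<in> ?R\<^sup>*")
proof -
  have "sym ?R"
  proof (rule symI)
    fix a b assume "(a, b) \<in> ?R"
    then obtain x i where x: "x \<in> S" "i \<le> n" "sn x i \<noteq> 0" "a = rshape x" "b = flip i (rshape x)"
      by (auto simp: st_rshape)
    then have "b = rshape (mv i x)" "mv i x \<in> S" "sn (mv i x) i \<noteq> 0" "a = flip i b"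
      using flip_rshape mv_closed sn_mv flip_flip_rshape by auto
    then show "(b, a) \<in> ?R" using x by (auto simp: st_rshape intro!: exI[of _ b] exI[of _ i])
  qed
  then have sym: "sym (?R\<^sup>*)" by (rule sym_rtrancl)
  have from_x0: "(rshape x0, rshape x) \<in> ?R\<^sup>*" if "x \<in> S" for x
    using reachable[OF that]
  proof (induction rule: rtrancl_induct)
    case base
    then show ?case by simp
  next
    case (step y z)
    then obtain i where "y \<in> S" "i \<le> n" "sn y i \<noteq> 0" "z = mv i y" by auto
    then have "(rshape y, rshape z) \<in> ?R"
      by (auto simp: st_rshape flip_rshape intro!: exI[of _ "rshape y"] exI[of _ i])
    then show ?case using step by (meson rtrancl.rtrancl_into_rtrancl)
  qed
  show ?thesis using from_x0 assms sym by (meson rtrancl_trans symD)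
qed

lemma e_nonzero: "e \<noteq> 0" and e_square: "e\<^sup>2 \<noteq> 1"
  using root N_ge by (auto simp: primitive_root_of_unity_def power_0_left)

lemma flip_system_rshape: "flip_system n e (rshape ` S) st u flip"
proof
  show "e \<noteq> 0" "e\<^sup>2 \<noteq> 1" by (fact e_nonzero e_square)+
  show "finite (rshape ` S)" by (fact finite_rshape)
  show "rshape ` S \<noteq> {}" using x0_in by blast
next
  fix b i assume b: "b \<in> rshape ` S" and i: "i \<le> n"
  then obtain x where x: "x \<in> S" "b = rshape x" by blast
  show "st b i \<in> {-1, 0, 1}" using x i sn_range by (simp add: st_rshape)
  show "u b i \<noteq> 0" using e_nonzero by (simp add: u_def)
  assume "st b i \<noteq> 0"
  then have nz: "sn x i \<noteq> 0" using x i by (simp add: st_rshape)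
  note mv = mv_closed[OF x(1) i nz] sn_mv[OF x(1) i nz] ht_mv[OF x(1) i nz]
  show "flip i b \<in> rshape ` S" using x i nz flip_rshape mv_closed by simp
  show "flip i (flip i b) = b" using x i nz flip_flip_rshape by simp
  show "st (flip i b) i = - st b i" using x i nz by (simp add: flip_rshape st_rshape sn_mv)
  show "u (flip i b) i = u b i" using x i nz mv by (simp add: flip_rshape u_rshape add.commute)
  fix j assume j: "j \<le> n"
  {
    assume a: "adj n i j"
    show s: "st (flip i b) j = st b j + st b i"
      using x i j nz a by (simp add: flip_rshape st_rshape sn_mv_adj)
    assume "st b j = 0"
    then have "sn x j = 0" "sn (mv i x) j \<noteq> 0"
      using x j i nz a by (simp_all add: st_rshape sn_mv_adj)
    then show "u (flip i b) j = u b i * e powi st b i"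
      using x i j nz a mv e_nonzero
      by (simp add: flip_rshape u_rshape st_rshape ht_mv_adj sn_mv_adj flip: power_int_add)
  next
    assume a: "j \<noteq> i" "\<not> adj n i j"
    show "st (flip i b) j = st b j" "u (flip i b) j = u b j"
      using flip_far[OF a] by (simp_all add: st_def u_def position_def)
    show "flip j (flip i b) = flip i (flip j b)" using flip_far_commute i j a by blast
  }
next
  fix b b' assume "b \<in> rshape ` S" "b' \<in> rshape ` S"
  then obtain x y where xy: "x \<in> S" "y \<in> S" "b = rshape x" "b' = rshape y" by blast
  assume "\<And>i. i \<le> n \<Longrightarrow> st b i = st b' i" "\<And>i. i \<le> n \<Longrightarrow> st b i \<noteq> 0 \<Longrightarrow> u b i = u b' i"
  then show "b = b'" unfolding xy by (intro rshape_eqI) (auto simp: xy st_rshape)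
next
  fix b b' assume "b \<in> rshape ` S" "b' \<in> rshape ` S"
  then show "(b, b') \<in> {(c, flip i c) | c i. c \<in> rshape ` S \<and> i \<le> n \<and> st c i \<noteq> 0}\<^sup>*"
    using rshape_connected by blast
qed

text \<open>The theorem for any crystal of thin monomials; what remains for a concrete one is to count
  the reductions.\<close>

lemma module_of_subcrystal:
  assumes m0: "expo m0 = shape x0" "m0 \<in> monomial_group n s"
  defines "E \<equiv> subcrystal n s m0"
  shows "\<exists>(V :: (rmonomial \<Rightarrow> complex) set) act.
    toroidal_module fscale n e V act \<and>
    toroidal_module.irreducible_module fscale n V act \<and>
    vector_space.dim fscale V = card (rshape ` S) \<and>
    has_qcharacter fscale n e N V act (reduce N ` E) \<and>
    (\<exists>v. indexed_basis fscale V (reduce N ` E) v \<and>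
      (\<forall>m \<in> E. \<forall>i\<le>n.
        (\<forall>a::int. act (X Plus i a) (v (reduce N m))
            = fscale (e powi (a * (p_ind m i - 1))) (vec_at N v (e_op n i m))) \<and>
        (\<forall>a::int. act (X Minus i a) (v (reduce N m))
            = fscale (e powi (a * (q_ind m i + 1))) (vec_at N v (f_op n i m))) \<and>
        (\<forall>\<sigma>. \<forall>t::int. t > 0 \<longrightarrow>
            phi_gen fscale e act \<sigma> i (sg \<sigma> * t) (v (reduce N m))
            = fscale (of_int (sg \<sigma>) * (e - inverse e) *
                 (of_int (phi m i) * e powi (sg \<sigma> * t * (q_ind m i + 1))
                  - of_int (eps m i) * e powi (sg \<sigma> * t * (p_ind m i - 1))))
                (v (reduce N m))) \<and>
        (\<forall>\<sigma>. act (K \<sigma> i) (v (reduce N m))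
            = fscale (e powi (sg \<sigma> * (phi m i - eps m i))) (v (reduce N m)))))"
proof -
  interpret fs: flip_system n e "rshape ` S" st u flip by (rule flip_system_rshape)
  have E: "reduce N ` E = rshape ` S"
  proof (intro equalityI subsetI)
    fix b assume "b \<in> reduce N ` E"
    then obtain m where m: "m \<in> subcrystal n s m0" "b = reduce N m" by (auto simp: E_def)
    obtain x where "x \<in> S" "expo m = shape x" using subcrystal_shape[OF m0(1) m(1)] by blast
    then show "b \<in> rshape ` S" using m reduce_shape by simp
  next
    fix b assume "b \<in> rshape ` S"
    then obtain x where x: "x \<in> S" "b = rshape x" by blast
    obtain m where "m \<in> subcrystal n s m0" "expo m = shape x"
      using shape_in_subcrystal[OF m0 x(1)] by blast
    then show "b \<in> reduce N ` E" unfolding E_def x(2) by (intro image_eqI[of _ _ m]) (simp_all add: reduce_shape)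
  qed
  have "has_qcharacter fscale n e N fs.V fs.act (rshape ` S)"
    unfolding has_qcharacter_def
  proof (intro exI[of _ delta] conjI ballI allI impI)
    show "indexed_basis fscale fs.V (rshape ` S) delta" by (rule fs.basis_delta)
    fix b i \<sigma> and t :: nat assume b: "b \<in> rshape ` S" and i: "i \<le> n"
    then obtain x where x: "x \<in> S" "b = rshape x" by blast
    have "fps_nth (eigenvalue_series e N \<sigma> b i) t = fs.phi_eig \<sigma> b i (sg \<sigma> * int t)"
    proof (rule fs.eigenvalue_series_single[OF b i])
      show "0 \<le> ht x i mod int N" "ht x i mod int N < int N" using N_pos by simp_all
      show "b i = (\<lambda>c. if c = ht x i mod int N then st b i else 0)"
        unfolding x(2) st_rshape[OF i] using i by (simp add: rshape_def single_def)
      show "u b i = e powi (ht x i mod int N + st b i)" if "st b i \<noteq> 0"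
      proof -
        have "\<bar>sn x i\<bar> = 1" using sn_range[OF x(1) i] that i by (auto simp: x st_rshape)
        then show ?thesis using i by (simp add: u_def x position_rshape st_rshape)
      qed
    qed
    then show "phi_gen fscale e fs.act \<sigma> i (sg \<sigma> * int t) (delta b)
        = fscale (fps_nth (eigenvalue_series e N \<sigma> b i) t) (delta b)"
      using b i by (simp add: fs.phi_gen_delta)
  qed
  moreover have "fs.act (X Plus i a) (delta (reduce N m))
            = fscale (e powi (a * (p_ind m i - 1))) (vec_at N delta (e_op n i m))"
      (is "?raise i a m")
    and "fs.act (X Minus i a) (delta (reduce N m))
            = fscale (e powi (a * (q_ind m i + 1))) (vec_at N delta (f_op n i m))"
      (is "?lower i a m")
    and "t > 0 \<Longrightarrow> phi_gen fscale e fs.act \<sigma> i (sg \<sigma> * t) (delta (reduce N m))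
            = fscale (of_int (sg \<sigma>) * (e - inverse e) *
                 (of_int (phi m i) * e powi (sg \<sigma> * t * (q_ind m i + 1))
                  - of_int (eps m i) * e powi (sg \<sigma> * t * (p_ind m i - 1))))
                (delta (reduce N m))"
      (is "_ \<Longrightarrow> ?series \<sigma> i t m")
    and "fs.act (K \<sigma> i) (delta (reduce N m))
            = fscale (e powi (sg \<sigma> * (phi m i - eps m i))) (delta (reduce N m))"
      (is "?weight \<sigma> i m")
    if "m \<in> E" and i: "i \<le> n" for m i a \<sigma> t
  proof -
    obtain x where x: "x \<in> S" and m: "expo m = shape x"
      using subcrystal_shape[OF m0(1)] \<open>m \<in> E\<close> unfolding E_def by blast
    define b where "b = reduce N m"
    have bx: "b = rshape x" and b: "b \<in> rshape ` S" using m x by (simp_all add: b_def reduce_shape)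
    have mi: "expo m i = single (ht x i) (sn x i)" using i by (simp add: m shape_def)
    note data = phi_eps_single[OF mi sn_range[OF x i]]
    have st: "st b i = sn x i" using i by (simp add: bx st_rshape)
    have flip: "sn x i \<noteq> 0 \<Longrightarrow> flip i b = rshape (mv i x)" using flip_rshape[OF x i] bx by simp
    have u: "sn x i \<noteq> 0 \<Longrightarrow> u b i = e powi (ht x i + sn x i)" using u_rshape[OF x i] bx by simp
    show "?raise i a m"
    proof (cases "sn x i = -1")
      case True
      then obtain m' where "e_op n i m = Some m'" "expo m' = shape (mv i x)"
        using step_single(2)[OF x i m] by blast
      then show ?thesis unfolding b_def[symmetric] using True b i st flip u data
        by (simp add: fs.act_X_delta sg_def vec_at_def reduce_shape mult.commute flip: power_int_mult)
    next
      case False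
      then show ?thesis unfolding b_def[symmetric] using b i st step_single(4)[OF x i m]
        by (simp add: fs.act_X_delta sg_def vec_at_def fscale_def fun_eq_iff)
    qed
    show "?lower i a m"
    proof (cases "sn x i = 1")
      case True
      then obtain m' where "f_op n i m = Some m'" "expo m' = shape (mv i x)"
        using step_single(1)[OF x i m] by blast
      then show ?thesis unfolding b_def[symmetric] using True b i st flip u data
        by (simp add: fs.act_X_delta sg_def vec_at_def reduce_shape mult.commute flip: power_int_mult)
    next
      case False
      then show ?thesis unfolding b_def[symmetric] using b i st step_single(3)[OF x i m]
        by (simp add: fs.act_X_delta sg_def vec_at_def fscale_def fun_eq_iff)
    qed
    show "?series \<sigma> i t m" if "t > 0"
    proof -
      have pos: "\<not> sg \<sigma> * (sg \<sigma> * t) < 0" "sg \<sigma> * t \<noteq> 0"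
        using that by (cases \<sigma>; simp add: sg_def)+
      consider "sn x i = 0" | "sn x i = 1" | "sn x i = -1" using sn_range[OF x i] by auto
      then have "fs.phi_eig \<sigma> b i (sg \<sigma> * t) = of_int (sg \<sigma>) * (e - inverse e) *
                 (of_int (phi m i) * e powi (sg \<sigma> * t * (q_ind m i + 1))
                  - of_int (eps m i) * e powi (sg \<sigma> * t * (p_ind m i - 1)))"
        using pos by cases (simp_all add: fs.phi_eig_def st u data mult.commute flip: power_int_mult)
      then show ?thesis unfolding b_def[symmetric] using b i by (simp add: fs.phi_gen_delta)
    qed
    show "?weight \<sigma> i m"
      unfolding b_def[symmetric] using b data sn_range[OF x i] by (auto simp: fs.act_K_delta st)
  qed
  ultimately show ?thesis
    unfolding E using fs.toroidal_module_act fs.irreducible_act fs.dim_V fs.basis_delta by blast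
qed

end

section \<open>The crystals of the first and the last fundamental weight\<close>

text \<open>The parameter \<open>x\<close> stands for the monomial $Y_{dx,x-1}Y_{d(x-1),x}^{-1}$, the first index being taken
  modulo \<open>n + 1\<close>. The direction is \<open>d = 1\<close> for $\ell = 1$ and \<open>d = -1\<close> for $\ell = n$.\<close>

definition line_index :: "nat \<Rightarrow> int \<Rightarrow> int \<Rightarrow> nat" where
  "line_index n d x = nat ((d * x) mod int (n + 1))"

definition line_sign :: "nat \<Rightarrow> int \<Rightarrow> int \<Rightarrow> nat \<Rightarrow> int" where
  "line_sign n d x i = (if i = line_index n d x then 1 else 0) - (if i = line_index n d (x - 1) then 1 else 0)"

definition line_height :: "nat \<Rightarrow> int \<Rightarrow> int \<Rightarrow> nat \<Rightarrow> int" where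
  "line_height n d x i = (if i = line_index n d x then x - 1 else x)"

definition line_move :: "nat \<Rightarrow> int \<Rightarrow> nat \<Rightarrow> int \<Rightarrow> int" where
  "line_move n d i x = (if i = line_index n d x then x + 1 else x - 1)"

lemma line_index_le: "line_index n d x \<le> n"
proof -
  have "(d * x) mod int (n + 1) < int (n + 1)" by (rule pos_mod_bound) simp
  then show ?thesis unfolding line_index_def by linarith
qed

lemma line_index_eq_iff:
  assumes "d \<in> {1, -1}"
  shows "line_index n d x = line_index n d y \<longleftrightarrow> int (n + 1) dvd x - y"
proof -
  have "line_index n d x = line_index n d y \<longleftrightarrow> (d * x) mod int (n + 1) = (d * y) mod int (n + 1)"
    unfolding line_index_def by (subst eq_nat_nat_iff) simp_all
  also have "\<dots> \<longleftrightarrow> int (n + 1) dvd d * (x - y)"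
    by (simp add: mod_eq_dvd_iff right_diff_distrib)
  also have "\<dots> \<longleftrightarrow> int (n + 1) dvd x - y"
    using assms dvd_minus_iff[of "int (n + 1)" "x - y"] by auto
  finally show ?thesis .
qed

lemma adj_line_index:
  assumes "d \<in> {1, -1}"
  shows "adj n (line_index n d x) j \<longleftrightarrow> j = line_index n d (x + 1) \<or> j = line_index n d (x - 1)"
proof -
  have nxt: "nxt n (nat (y mod int (n + 1))) = nat ((y + 1) mod int (n + 1))" for y
    
  proof -
    have "int (nxt n (nat (y mod int (n + 1)))) = int (nat ((y + 1) mod int (n + 1)))"
      by (simp add: nxt_def zmod_int mod_add_right_eq add.commute)
    then show ?thesis by simp
  qed
  have prv: "prv n (nat (y mod int (n + 1))) = nat ((y - 1) mod int (n + 1))" for y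
  proof -
    have "(y mod int (n + 1) + int n) mod int (n + 1) = (y - 1 + int (n + 1)) mod int (n + 1)"
      by (subst mod_add_left_eq) (simp add: algebra_simps)
    also have "\<dots> = (y - 1) mod int (n + 1)" by (rule mod_add_self2)
    finally have "int (prv n (nat (y mod int (n + 1)))) = int (nat ((y - 1) mod int (n + 1)))"
      by (simp add: prv_def zmod_int)
    then show ?thesis by simp
  qed
  have "d * (x + 1) = d * x + d" "d * (x - 1) = d * x - d" by (simp_all add: algebra_simps)
  then show ?thesis
    using assms unfolding adj_def line_index_def nxt prv by auto
qed

lemma line_index_neighbours:
  assumes d: "d \<in> {1, -1}" and n: "n \<ge> 2"
  shows "line_index n d (x + 1) \<noteq> line_index n d x" "line_index n d (x - 1) \<noteq> line_index n d x"
    "line_index n d (x + 1) \<noteq> line_index n d (x - 1)"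
    "line_index n d (x - 2) \<noteq> line_index n d x" "line_index n d (x - 2) \<noteq> line_index n d (x - 1)"
proof -
  have *: "\<not> int (n + 1) dvd k" if "k \<in> {1, 2, -1, -2}" for k
  proof
    assume "int (n + 1) dvd k"
    then have "\<bar>int (n + 1)\<bar> \<le> \<bar>k\<bar>" using that by (intro dvd_imp_le_int) auto
    then show False using that n by auto
  qed
  show "line_index n d (x + 1) \<noteq> line_index n d x" "line_index n d (x - 1) \<noteq> line_index n d x"
    "line_index n d (x + 1) \<noteq> line_index n d (x - 1)"
    "line_index n d (x - 2) \<noteq> line_index n d x" "line_index n d (x - 2) \<noteq> line_index n d (x - 1)"
    unfolding line_index_eq_iff[OF d]
    using *[of 1] *[of 2] *[of "-1"] *[of "-2"] by simp_all
qed

text \<open>The crystal is a line: only \<open>dx\<close> and \<open>d(x - 1)\<close> can be flipped, leading to \<open>x + 1\<close> and \<open>x - 1\<close>.\<close>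

lemma thin_family_line:
  assumes d: "d \<in> {1, -1}" and n: "n \<ge> 2"
  shows "thin_family n UNIV (line_sign n d) (line_height n d) (line_move n d) 1"
proof
  note ne = line_index_neighbours[OF d n]
  note defs = line_sign_def line_height_def line_move_def
  show "2 \<le> n" by (rule n)
  show "line_sign n d x i \<in> {-1, 0, 1}" for x i by (simp add: line_sign_def)
  show "(1 :: int) \<in> UNIV" "line_move n d i x \<in> UNIV" for i x by simp_all
  fix x i assume "line_sign n d x i \<noteq> 0"
  then have i: "i = line_index n d x \<or> i = line_index n d (x - 1)"
    by (auto simp: line_sign_def split: if_splits)
  show "line_sign n d (line_move n d i x) i = - line_sign n d x i"
    using i ne[of x] by (auto simp: defs)
  show "line_height n d (line_move n d i x) i = line_height n d x i + 2 * line_sign n d x i"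
    using i ne[of x] by (auto simp: defs)
  fix j
  {
    assume "adj n i j"
    then have j: "i = line_index n d x \<and> (j = line_index n d (x + 1) \<or> j = line_index n d (x - 1))
      \<or> i = line_index n d (x - 1) \<and> (j = line_index n d x \<or> j = line_index n d (x - 2))"
      using i adj_line_index[OF d, of n x j] adj_line_index[OF d, of n "x - 1" j] by auto
    show "line_sign n d (line_move n d i x) j = line_sign n d x j + line_sign n d x i"
      using j ne[of x] by (auto simp: defs)
    show "line_sign n d x j = 0 \<Longrightarrow> line_height n d (line_move n d i x) j = line_height n d x i + line_sign n d x i"
      using j ne[of x] by (auto simp: defs)
    show "line_sign n d x j \<noteq> 0 \<Longrightarrow> line_height n d x j = line_height n d x i + line_sign n d x i"
      using j ne[of x] by (auto simp: defs)
  next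
    assume "j \<noteq> i" "\<not> adj n i j"
    then have j: "i = line_index n d x \<and> j \<notin> {line_index n d x, line_index n d (x + 1), line_index n d (x - 1)}
      \<or> i = line_index n d (x - 1) \<and> j \<notin> {line_index n d (x - 1), line_index n d x, line_index n d (x - 2)}"
      using i adj_line_index[OF d, of n x j] adj_line_index[OF d, of n "x - 1" j] by auto
    have 0: "line_sign n d x j = 0" using j by (auto simp: line_sign_def)
    have "line_sign n d (line_move n d i x) j = 0"
      using j ne(2)[of x] by (elim disjE) (simp_all add: defs)
    then show "line_sign n d (line_move n d i x) j = line_sign n d x j" using 0 by simp
    show "line_sign n d x j \<noteq> 0 \<Longrightarrow> line_height n d (line_move n d i x) j = line_height n d x j"
      using 0 by simp
  }
next
  let ?R = "{(y, line_move n d i y) |y i. y \<in> UNIV \<and> i \<le> n \<and> line_sign n d y i \<noteq> 0}"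
  note ne = line_index_neighbours[OF d n]
  have up: "(y, y + 1) \<in> ?R" for y
    using ne[of y] line_index_le[of n d y]
    by (auto simp: line_move_def line_sign_def intro!: exI[of _ "line_index n d y"])
  have down: "(y, y - 1) \<in> ?R" for y
    using ne[of y] line_index_le[of n d "y - 1"]
    by (auto simp: line_move_def line_sign_def intro!: exI[of _ "line_index n d (y - 1)"])
  fix x :: int
  show "(1, x) \<in> ?R\<^sup>*"
  proof (induction x rule: int_induct[of _ 1])
    case base
    then show ?case by simp
  next
    case (step1 i)
    then show ?case using up[of i] by (meson rtrancl.rtrancl_into_rtrancl)
  next
    case (step2 i)
    then show ?case using down[of i] by (meson rtrancl.rtrancl_into_rtrancl)
  qed
qed

text \<open>The reduction of \<open>x\<close> determines \<open>x\<close> modulo $(n+1)L$, because the second index of its positive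
  factor is \<open>x - 1\<close>; conversely the first indices depend on \<open>x\<close> modulo \<open>n + 1\<close> only.\<close>

lemma card_line:
  assumes d: "d \<in> {1, -1}" and n: "n \<ge> 2" and L: "L \<ge> 1"
    and root: "primitive_root_of_unity ((n + 1) * L) e"
  shows "card (thin_family_root.rshape n (line_sign n d) (line_height n d) ((n + 1) * L) ` UNIV) = (n + 1) * L"
proof -
  define N where "N = (n + 1) * L"
  have N3: "N \<ge> 3" using n L mult_le_mono[of 3 "n + 1" 1 L] by (simp add: N_def)
  interpret thin_family_root n UNIV "line_sign n d" "line_height n d" "line_move n d" 1 N e
    by (intro thin_family_root.intro thin_family_root_axioms.intro thin_family_line d n N3)
      (use root in \<open>simp add: N_def\<close>)
  note ne = line_index_neighbours[OF d n]
  have eq: "rshape x = rshape y \<longleftrightarrow> x mod int N = y mod int N" for x y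
  proof
    assume *: "rshape x = rshape y"
    let ?i = "line_index n d x"
    have 1: "line_sign n d x ?i = 1" using ne[of x] by (simp add: line_sign_def)
    have "line_sign n d y ?i = line_sign n d x ?i"
      using * st_rshape[OF line_index_le] by metis
    then have 2: "line_sign n d y ?i = 1" using 1 by simp
    then have i: "?i = line_index n d y"
      unfolding line_sign_def by (cases "?i = line_index n d y"; cases "?i = line_index n d (y - 1)") simp_all
    have "rshape x ?i = single ((x - 1) mod int N) 1"
      using line_index_le[of n d x] by (simp add: rshape_def line_height_def 1)
    moreover have "rshape y ?i = single ((y - 1) mod int N) 1"
      using line_index_le[of n d y] 2[unfolded i] unfolding i by (simp add: rshape_def line_height_def)
    ultimately have "single ((x - 1) mod int N) 1 = single ((y - 1) mod int N) 1"
      using * by simp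
    then have "single ((x - 1) mod int N) 1 ((x - 1) mod int N) = single ((y - 1) mod int N) 1 ((x - 1) mod int N)"
      by (rule fun_cong)
    then have "(x - 1) mod int N = (y - 1) mod int N" by (simp add: single_def split: if_splits)
    then have "(x - 1 + 1) mod int N = (y - 1 + 1) mod int N" by (intro mod_add_cong) auto
    then show "x mod int N = y mod int N" by simp
  next
    assume *: "x mod int N = y mod int N"
    have "int (n + 1) dvd int N" unfolding N_def of_nat_mult by (rule dvd_triv_left)
    then have "int (n + 1) dvd x - y" using * by (metis dvd_trans mod_eq_dvd_iff)
    then have i: "line_index n d x = line_index n d y" "line_index n d (x - 1) = line_index n d (y - 1)"
      by (simp_all add: line_index_eq_iff[OF d])
    have "(x - 1) mod int N = (y - 1) mod int N" using * by (intro mod_diff_cong) auto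
    then show "rshape x = rshape y"
      using * by (intro ext) (simp add: rshape_def line_height_def line_sign_def i)
  qed
  have "rshape ` UNIV = rshape ` {0..<int N}"
  proof -
    have "rshape x \<in> rshape ` {0..<int N}" for x
      using N_pos by (intro image_eqI[of _ _ "x mod int N"]) (simp_all add: eq)
    then show ?thesis by blast
  qed
  moreover have "inj_on rshape {0..<int N}" by (intro inj_onI) (simp add: eq)
  ultimately have "card (rshape ` UNIV) = N" by (simp add: card_image)
  then show ?thesis by (simp only: N_def)
qed

lemma start_monomial_line:
  assumes d: "d \<in> {1, -1}" and n: "n \<ge> 2" and l: "l = (if d = 1 then 1 else n)"
  shows "expo (start_monomial n l) = thin_family.shape n (line_sign n d) (line_height n d) 1"
proof -
  interpret thin_family n UNIV "line_sign n d" "line_height n d" "line_move n d" 1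
    by (rule thin_family_line[OF d n])
  have i0: "line_index n d 0 = 0" by (simp add: line_index_def)
  have "(- 1) mod (1 + int n) = int n" using n by (simp add: zmod_minus1)
  then have i1: "line_index n d 1 = l" using d l n by (auto simp: line_index_def)
  have m: "min l (n + 1 - l) = 1" "l \<le> n" "l \<noteq> 0" using l n by auto
  show ?thesis
    using m by (auto simp: fun_eq_iff shape_def single_def line_sign_def line_height_def i0 i1
        start_monomial_def mexp_def mtimes_def minv_def mY_def)
qed

section \<open>The crystal of the middle fundamental weight\<close>

text \<open>Functions on the cycle of length \<open>n + 1 = 2 * r + 2\<close> with steps $\pm1$, extended by 0 to all
  natural numbers. Since they change parity at each step, the condition at 0 fixes the parity at
  every node; it is the one of \<open>valley r\<close>, which stands for the generating monomial.\<close>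

definition height_functions :: "nat \<Rightarrow> (nat \<Rightarrow> int) set" where
  "height_functions r = {h. (\<forall>i\<le>2 * r + 1. h (nxt (2 * r + 1) i) - h i \<in> {1, -1})
     \<and> (\<forall>i>2 * r + 1. h i = 0) \<and> even (h 0 - int (r + 1))}"

text \<open>Half of the discrete Laplacian: 1 at local minima, -1 at local maxima, 0 on slopes.\<close>

definition height_sign :: "nat \<Rightarrow> (nat \<Rightarrow> int) \<Rightarrow> nat \<Rightarrow> int" where
  "height_sign n h i = ((h (nxt n i) - h i) + (h (prv n i) - h i)) div 2"

definition height_move :: "nat \<Rightarrow> nat \<Rightarrow> (nat \<Rightarrow> int) \<Rightarrow> nat \<Rightarrow> int" where
  "height_move n i h = h(i := h i + 2 * height_sign n h i)"

definition valley :: "nat \<Rightarrow> nat \<Rightarrow> int" where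
  "valley r i = (if i \<le> 2 * r + 1 then \<bar>int i - int (r + 1)\<bar> else 0)"

lemma height_step:
  assumes "h \<in> height_functions r" "i \<le> 2 * r + 1"
  shows "h (nxt (2 * r + 1) i) = h i + 1 \<or> h (nxt (2 * r + 1) i) = h i - 1"
    and "h (prv (2 * r + 1) i) = h i + 1 \<or> h (prv (2 * r + 1) i) = h i - 1"
proof -
  have step: "h (nxt (2 * r + 1) j) = h j + 1 \<or> h (nxt (2 * r + 1) j) = h j - 1" if "j \<le> 2 * r + 1" for j
  proof -
    have "h (nxt (2 * r + 1) j) - h j \<in> {1, -1}" using assms(1) that by (simp add: height_functions_def)
    then show ?thesis by auto
  qed
  show "h (nxt (2 * r + 1) i) = h i + 1 \<or> h (nxt (2 * r + 1) i) = h i - 1" using step assms by blast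
  have "prv (2 * r + 1) i \<le> 2 * r + 1" by (rule prv_le)
  from step[OF this] show "h (prv (2 * r + 1) i) = h i + 1 \<or> h (prv (2 * r + 1) i) = h i - 1"
    using nxt_prv[OF assms(2)] by auto
qed

lemma height_parity:
  assumes h: "h \<in> height_functions r" and "i \<le> 2 * r + 1"
  shows "even (h i - int (r + 1) - int i)"
  using assms(2)
proof (induction i)
  case 0
  then show ?case using h by (simp add: height_functions_def)
next
  case (Suc i)
  then have "h (Suc i) = h i + 1 \<or> h (Suc i) = h i - 1"
    using height_step(1)[OF h, of i] by (simp add: nxt_eq)
  moreover have "even (h i - int (r + 1) - int i)" using Suc by simp
  ultimately show ?case by (elim disjE) (simp_all, presburger+)
qed

lemma height_sign_neighbours:
  assumes h: "h \<in> height_functions r" and i: "i \<le> 2 * r + 1"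
  shows "2 * height_sign (2 * r + 1) h i = h (nxt (2 * r + 1) i) + h (prv (2 * r + 1) i) - 2 * h i"
    and "height_sign (2 * r + 1) h i \<in> {-1, 0, 1}"
    and "height_sign (2 * r + 1) h i \<noteq> 0 \<Longrightarrow> adj (2 * r + 1) i j \<Longrightarrow> h j = h i + height_sign (2 * r + 1) h i"
  using height_step[OF assms] by (auto simp: height_sign_def adj_def)

lemma height_move_closed:
  assumes h: "h \<in> height_functions r" and i: "i \<le> 2 * r + 1" and nz: "height_sign (2 * r + 1) h i \<noteq> 0"
  shows "height_move (2 * r + 1) i h \<in> height_functions r"
proof -
  let ?n = "2 * r + 1" and ?s = "height_sign (2 * r + 1) h i"
  let ?g = "height_move ?n i h"
  have s: "?s = 1 \<or> ?s = -1" using height_sign_neighbours(2)[OF h i] nz by auto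
  have "?g (nxt ?n k) - ?g k \<in> {1, -1}" if k: "k \<le> ?n" for k
  proof -
    have irr: "nxt ?n i \<noteq> i" using adj_irrefl[of ?n i] i by (auto simp: adj_def)
    consider "k = i" | "k \<noteq> i" "nxt ?n k = i" | "k \<noteq> i" "nxt ?n k \<noteq> i" by blast
    then show ?thesis
    proof cases
      case 1
      have "h (nxt ?n i) = h i + ?s" using height_sign_neighbours(3)[OF h i nz] by (simp add: adj_def)
      then show ?thesis using 1 irr s by (auto simp: height_move_def)
    next
      case 2
      then have "k = prv ?n i" using prv_nxt[OF k] by simp
      then have "h k = h i + ?s" using height_sign_neighbours(3)[OF h i nz] by (simp add: adj_def)
      then show ?thesis using 2 s by (auto simp: height_move_def)
    next
      case 3
      then show ?thesis using h k by (simp add: height_move_def height_functions_def)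
    qed
  qed
  moreover have "even (?g 0 - int (r + 1))"
    using h by (auto simp: height_move_def height_functions_def)
  ultimately show ?thesis using h i by (auto simp: height_functions_def height_move_def)
qed

text \<open>Twice the sign is the linear expression \<open>h (i + 1) + h (i - 1) - 2 h i\<close>, so raising \<open>h i\<close> by
  $2\sigma$ changes the sign by $-2\sigma$ at \<open>i\<close> and by $\sigma$ at the two neighbours.\<close>

lemma height_sign_move:
  assumes h: "h \<in> height_functions r" and r: "r \<ge> 1" and i: "i \<le> 2 * r + 1"
    and nz: "height_sign (2 * r + 1) h i \<noteq> 0" and j: "j \<le> 2 * r + 1"
  shows "height_sign (2 * r + 1) (height_move (2 * r + 1) i h) j
    = (if j = i then - height_sign (2 * r + 1) h i
       else if adj (2 * r + 1) i j then height_sign (2 * r + 1) h j + height_sign (2 * r + 1) h i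
       else height_sign (2 * r + 1) h j)"
proof -
  let ?n = "2 * r + 1" and ?s = "height_sign (2 * r + 1) h i"
  let ?g = "height_move ?n i h"
  have irr: "nxt ?n k \<noteq> k" "prv ?n k \<noteq> k" if "k \<le> ?n" for k
    using adj_irrefl[of ?n k] that by (auto simp: adj_def)
  note g2 = height_sign_neighbours(1)[OF height_move_closed[OF h i nz] j]
  note h2 = height_sign_neighbours(1)[OF h j]
  consider "j = i" | "j \<noteq> i" "j = nxt ?n i" | "j \<noteq> i" "j = prv ?n i" | "j \<noteq> i" "\<not> adj ?n i j"
    by (auto simp: adj_def)
  then show ?thesis
  proof cases
    case 1
    then have "2 * height_sign ?n ?g j = 2 * (- ?s)"
      using g2 h2 irr[OF i] by (simp add: height_move_def)
    then show ?thesis using 1 by simp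
  next
    case 2
    have "nxt ?n j \<noteq> i" using nxt_neq_prv[OF _ j] prv_nxt[OF i] 2 r by auto
    then have "2 * height_sign ?n ?g j = 2 * (height_sign ?n h j + ?s)"
      using g2 h2 2 prv_nxt[OF i] by (simp add: height_move_def)
    then show ?thesis using 2 by (simp add: adj_def)
  next
    case 3
    have "prv ?n j \<noteq> i" using nxt_neq_prv[OF _ j] nxt_prv[OF i] 3 r by auto
    then have "2 * height_sign ?n ?g j = 2 * (height_sign ?n h j + ?s)"
      using g2 h2 3 nxt_prv[OF i] by (simp add: height_move_def)
    then show ?thesis using 3 by (simp add: adj_def)
  next
    case 4
    then have "\<not> adj ?n j i" using adj_sym i j by blast
    then have "2 * height_sign ?n ?g j = 2 * height_sign ?n h j"
      using g2 h2 4 by (auto simp: height_move_def adj_def)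
    then show ?thesis using 4 by simp
  qed
qed

definition height_steps :: "nat \<Rightarrow> ((nat \<Rightarrow> int) \<times> (nat \<Rightarrow> int)) set" where
  "height_steps r = {(h, height_move (2 * r + 1) i h) | h i.
     h \<in> height_functions r \<and> i \<le> 2 * r + 1 \<and> height_sign (2 * r + 1) h i \<noteq> 0}"

lemma sym_height_steps:
  assumes "r \<ge> 1"
  shows "sym ((height_steps r)\<^sup>*)"
proof (rule sym_rtrancl, rule symI)
  fix h g assume "(h, g) \<in> height_steps r"
  then obtain i where *: "h \<in> height_functions r" "i \<le> 2 * r + 1" "height_sign (2 * r + 1) h i \<noteq> 0"
    "g = height_move (2 * r + 1) i h" by (auto simp: height_steps_def)
  have "height_sign (2 * r + 1) g i = - height_sign (2 * r + 1) h i"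
    using height_sign_move[OF *(1) assms *(2,3,2)] * by simp
  then have "h = height_move (2 * r + 1) i g" "height_sign (2 * r + 1) g i \<noteq> 0"
    using * by (simp_all add: height_move_def)
  moreover have "g \<in> height_functions r" using * height_move_closed by simp
  ultimately show "(g, h) \<in> height_steps r" using * by (auto simp: height_steps_def)
qed

text \<open>Among the nodes where \<open>h < g\<close> choose one with \<open>h i\<close> minimal. It is a local minimum of \<open>h\<close>: a lower
  neighbour \<open>j\<close> would satisfy \<open>h j = g j\<close> by minimality, and then \<open>g i \<le> g j + 1 = h i\<close>. By parity
  \<open>h i + 2 \<le> g i\<close>, so flipping at \<open>i\<close> leaves \<open>h\<close> below \<open>g\<close> and brings it closer.\<close>

lemma height_steps_up:
  assumes r: "r \<ge> 1" and "h \<in> height_functions r" "g \<in> height_functions r" "\<And>i. i \<le> 2 * r + 1 \<Longrightarrow> h i \<le> g i"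
  shows "(h, g) \<in> (height_steps r)\<^sup>*"
  using assms(2-4)
proof (induction "nat (\<Sum>i\<le>2 * r + 1. g i - h i)" arbitrary: h rule: less_induct)
  case less
  let ?n = "2 * r + 1"
  note h = less.prems(1) and g = less.prems(2) and le = less.prems(3)
  show ?case
  proof (cases "\<exists>i\<le>?n. h i < g i")
    case False
    have "h i = g i" for i
    proof (cases "i \<le> ?n")
      case True
      then show ?thesis using le[OF True] False by (metis order_le_imp_less_or_eq)
    next
      case False
      then show ?thesis using h g by (simp add: height_functions_def)
    qed
    then have "h = g" by (rule ext)
    then show ?thesis by simp
  next
    case True
    let ?A = "{i. i \<le> ?n \<and> h i < g i}"
    have "finite ?A" "?A \<noteq> {}" using True by auto
    then obtain i where "is_arg_min h (\<lambda>i. i \<in> ?A) i"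
      using ex_is_arg_min_if_finite by blast
    then have i: "i \<le> ?n" "h i < g i" and min: "\<And>j. j \<le> ?n \<Longrightarrow> h j < g j \<Longrightarrow> h i \<le> h j"
      by (auto simp: is_arg_min_def not_less)
    have nb: "h j = h i + 1" if "adj ?n i j" for j
    proof -
      have j: "j \<le> ?n" using that nxt_le[of ?n i] prv_le[of ?n i] by (auto simp: adj_def)
      have hj: "h j = h i + 1 \<or> h j = h i - 1" and gj: "g j = g i + 1 \<or> g j = g i - 1"
        using height_step[OF h i(1)] height_step[OF g i(1)] that by (auto simp: adj_def)
      show ?thesis
      proof (rule ccontr)
        assume "h j \<noteq> h i + 1"
        then have "h j = h i - 1" using hj by simp
        then have "\<not> h j < g j" using min[OF j] by auto
        then show False using gj \<open>h j = h i - 1\<close> i by linarith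
      qed
    qed
    have s: "height_sign ?n h i = 1"
      using nb[of "nxt ?n i"] nb[of "prv ?n i"] by (simp add: height_sign_def adj_def)
    let ?h = "height_move ?n i h"
    have "even (g i - h i)"
      using height_parity[OF h i(1)] height_parity[OF g i(1)] by presburger
    then have two: "h i + 2 \<le> g i" using i by presburger
    have h': "?h \<in> height_functions r" using height_move_closed[OF h i(1)] s by simp
    have le': "?h k \<le> g k" if "k \<le> ?n" for k
      using le[OF that] two s by (auto simp: height_move_def)
    have "(\<Sum>k\<le>?n. g k - ?h k) < (\<Sum>k\<le>?n. g k - h k)"
      using i s by (intro sum_strict_mono_ex1) (auto simp: height_move_def)
    moreover have "0 \<le> (\<Sum>k\<le>?n. g k - ?h k)" using le' by (intro sum_nonneg) auto
    ultimately have "nat (\<Sum>k\<le>?n. g k - ?h k) < nat (\<Sum>k\<le>?n. g k - h k)" by simp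
    then have "(?h, g) \<in> (height_steps r)\<^sup>*" using less.hyps h' g le' by blast
    moreover have "(h, ?h) \<in> height_steps r"
      using h i s by (auto simp: height_steps_def intro!: exI[of _ h] exI[of _ i])
    ultimately show ?thesis by (rule converse_rtrancl_into_rtrancl[rotated])
  qed
qed

text \<open>Both functions lie below a translate of \<open>g\<close> by a large even constant.\<close>

lemma height_steps_connected:
  assumes r: "r \<ge> 1" and h: "h \<in> height_functions r" and g: "g \<in> height_functions r"
  shows "(h, g) \<in> (height_steps r)\<^sup>*"
proof -
  let ?n = "2 * r + 1"
  define K where "K = (\<Sum>i\<le>?n. \<bar>h i - g i\<bar>)"
  define g' where "g' = (\<lambda>i. if i \<le> ?n then g i + 2 * K else 0)"
  have g': "g' \<in> height_functions r"
    using g by (auto simp: height_functions_def g'_def nxt_le)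
  have "\<bar>h i - g i\<bar> \<le> K" if "i \<le> ?n" for i
    unfolding K_def using that by (intro member_le_sum) auto
  then have "h i \<le> g' i" "g i \<le> g' i" if "i \<le> ?n" for i
    using that by (force simp: g'_def)+
  then have "(h, g') \<in> (height_steps r)\<^sup>*" "(g, g') \<in> (height_steps r)\<^sup>*"
    using height_steps_up[OF r] h g g' by blast+
  then show ?thesis using sym_height_steps[OF r] by (meson rtrancl_trans symD)
qed

lemma valley_in: "valley r \<in> height_functions r"
proof -
  have "valley r (nxt (2 * r + 1) i) - valley r i \<in> {1, -1}" if "i \<le> 2 * r + 1" for i
    using that by (auto simp: nxt_eq valley_def)
  then show ?thesis by (auto simp: height_functions_def valley_def)
qed

lemma thin_family_height:
  assumes r: "r \<ge> 1" and n: "n = 2 * r + 1"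
  shows "thin_family n (height_functions r) (height_sign n) (\<lambda>h. h) (height_move n) (valley r)"
proof
  show "2 \<le> n" using r n by simp
  show "valley r \<in> height_functions r" by (rule valley_in)
  show "(valley r, h) \<in> {(h, height_move n i h) |h i. h \<in> height_functions r \<and> i \<le> n \<and> height_sign n h i \<noteq> 0}\<^sup>*"
    if "h \<in> height_functions r" for h
    using height_steps_connected[OF r valley_in that] by (simp add: height_steps_def n)
  fix h i assume h: "h \<in> height_functions r" and i: "i \<le> n"
  show "height_sign n h i \<in> {-1, 0, 1}" using height_sign_neighbours(2) h i n by simp
  assume nz: "height_sign n h i \<noteq> 0"
  note mv = height_sign_move[OF h r i[unfolded n] nz[unfolded n], folded n]
  show "height_move n i h \<in> height_functions r" using height_move_closed h i nz n by simp
  show "height_sign n (height_move n i h) i = - height_sign n h i" using mv i n by simp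
  show "height_move n i h i = h i + 2 * height_sign n h i" by (simp add: height_move_def)
  fix j assume j: "j \<le> n"
  {
    assume a: "adj n i j"
    then have ji: "j \<noteq> i" using adj_irrefl[of n i] i n by auto
    show "height_sign n (height_move n i h) j = height_sign n h j + height_sign n h i"
      using mv[of j] j n a ji by simp
    have "h j = h i + height_sign n h i"
      using height_sign_neighbours(3)[OF h i[unfolded n]] nz a n by simp
    then show "height_move n i h j = h i + height_sign n h i" "h j = h i + height_sign n h i"
      using ji by (simp_all add: height_move_def)
  next
    assume a: "j \<noteq> i" "\<not> adj n i j"
    show "height_sign n (height_move n i h) j = height_sign n h j" using mv[of j] j n a by simp
    show "height_move n i h j = h j" using a by (simp add: height_move_def)
  }
qed

lemma start_monomial_height:
  assumes r: "r \<ge> 1" and n: "n = 2 * r + 1"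
  shows "expo (start_monomial n (r + 1))
    = thin_family.shape n (height_sign n) (\<lambda>h. h) (valley r)"
proof -
  interpret thin_family n "height_functions r" "height_sign n" "\<lambda>h. h" "height_move n" "valley r"
    by (rule thin_family_height[OF r n])
  have s: "height_sign n (valley r) i = (if i = r + 1 then 1 else if i = 0 then -1 else 0)" if "i \<le> n" for i
  proof -
    consider "i = 0" | "i = n" | "0 < i" "i < n" using \<open>i \<le> n\<close> by linarith
    then show ?thesis
      using r n by cases (auto simp: height_sign_def nxt_eq prv_eq valley_def of_nat_diff)
  qed
  have m: "min (r + 1) (n + 1 - (r + 1)) = r + 1" using n by simp
  have v: "valley r (r + 1) = 0" "valley r 0 = int (r + 1)" by (simp_all add: valley_def)
  show ?thesis
  proof (intro ext)
    fix i c
    show "expo (start_monomial n (r + 1)) i c = shape (valley r) i c"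
    proof (cases "i \<le> n")
      case True
      then show ?thesis unfolding start_monomial_def m
        using v by (auto simp: shape_def single_def s mexp_def mtimes_def minv_def mY_def)
    next
      case False
      moreover have "i \<noteq> r + 1" "i \<noteq> 0" using False n by auto
      ultimately show ?thesis unfolding start_monomial_def m
        by (simp add: shape_def mexp_def mtimes_def minv_def mY_def)
    qed
  qed
qed

text \<open>The height function with value \<open>r + 1 + 2 a\<close> at 0 whose ascending steps are those starting in
  \<open>A\<close>; the path closes up when \<open>A\<close> contains half of the nodes.\<close>

definition path_of :: "nat \<Rightarrow> nat \<times> nat set \<Rightarrow> nat \<Rightarrow> int" where
  "path_of r = (\<lambda>(a, A) i. if i \<le> 2 * r + 1
     then int (r + 1) + 2 * int a + (\<Sum>k<i. if k \<in> A then 1 else -1) else 0)"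

lemma sum_signs:
  assumes "A \<subseteq> {..n}"
  shows "(\<Sum>k\<le>n. if k \<in> A then 1 else -1 :: int) = 2 * int (card A) - int (n + 1)"
proof -
  have fin: "finite A" using assms finite_subset by blast
  have "(\<Sum>k\<le>n. if k \<in> A then 1 else -1 :: int) = (\<Sum>k\<le>n. 2 * (if k \<in> A then 1 else 0) - 1)"
    by (intro sum.cong) auto
  also have "\<dots> = 2 * (\<Sum>k\<le>n. if k \<in> A then 1 else 0) - int (n + 1)"
    by (simp add: sum_subtractf sum_distrib_left)
  also have "(\<Sum>k\<le>n. if k \<in> A then 1 else 0 :: int) = (\<Sum>k\<in>{..n} \<inter> A. 1)"
    by (rule sum.inter_restrict[symmetric]) simp
  also have "\<dots> = int (card A)" using assms by (simp add: Int_absorb1)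
  finally show ?thesis .
qed

lemma path_of_step:
  assumes A: "A \<subseteq> {..2 * r + 1}" "card A = r + 1" and i: "i \<le> 2 * r + 1"
  shows "path_of r (a, A) (nxt (2 * r + 1) i) - path_of r (a, A) i = (if i \<in> A then 1 else -1)"
proof (cases "i = 2 * r + 1")
  case False
  then show ?thesis using i by (simp add: nxt_eq path_of_def)
next
  case True
  have "(\<Sum>k<Suc i. if k \<in> A then 1 else -1 :: int) = 0"
    unfolding lessThan_Suc_atMost True using sum_signs[OF A(1)] A(2) by simp
  then have "(\<Sum>k<i. if k \<in> A then 1 else -1 :: int) = - (if i \<in> A then 1 else -1)" by simp
  then show ?thesis using True by (simp add: nxt_eq path_of_def)
qed

lemma path_of_in:
  assumes "A \<subseteq> {..2 * r + 1}" "card A = r + 1"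
  shows "path_of r (a, A) \<in> height_functions r"
proof -
  have "path_of r (a, A) (nxt (2 * r + 1) i) - path_of r (a, A) i \<in> {1, -1}" if "i \<le> 2 * r + 1" for i
    unfolding path_of_step[OF assms that] by simp
  then show ?thesis by (simp add: height_functions_def) (simp add: path_of_def)
qed

lemma height_eq_sum_steps:
  assumes i: "i \<le> n"
  shows "h i = h 0 + (\<Sum>k<i. h (nxt n k) - h k :: int)"
proof -
  have "(\<Sum>k<i. h (nxt n k) - h k) = (\<Sum>k<i. h (Suc k) - h k)"
    using i by (intro sum.cong) (auto simp: nxt_eq)
  then show ?thesis by (simp add: sum_lessThan_telescope)
qed

lemma height_up_steps:
  assumes h: "h \<in> height_functions r"
  defines "A \<equiv> {k. k \<le> 2 * r + 1 \<and> h (nxt (2 * r + 1) k) - h k = 1}"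
  shows "A \<subseteq> {..2 * r + 1}" "card A = r + 1"
    and "i \<le> 2 * r + 1 \<Longrightarrow> h i = h 0 + (\<Sum>k<i. if k \<in> A then 1 else -1)"
proof -
  let ?n = "2 * r + 1"
  show A: "A \<subseteq> {..?n}" by (auto simp: A_def)
  have step: "h (nxt ?n k) - h k = (if k \<in> A then 1 else -1)" if "k \<le> ?n" for k
    using height_step(1)[OF h that] that by (auto simp: A_def)
  show hi: "h i = h 0 + (\<Sum>k<i. if k \<in> A then 1 else -1)" if "i \<le> ?n" for i
    by (subst height_eq_sum_steps[OF that]) (use step that in \<open>simp\<close>)
  have "(\<Sum>k\<le>?n. if k \<in> A then 1 else -1 :: int)
      = (\<Sum>k<?n. if k \<in> A then 1 else -1) + (h (nxt ?n ?n) - h ?n)"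
    using step[of ?n] by (simp flip: lessThan_Suc_atMost)
  also have "\<dots> = 0" using hi[of ?n] by (simp add: nxt_eq)
  finally show "card A = r + 1" using sum_signs[OF A] by simp
qed

text \<open>The signs are the second differences, so equal signs make the first differences of \<open>g - h\<close>
  constant around the cycle. At a local minimum of \<open>h\<close>, which is then one of \<open>g\<close> too, both functions
  go up, so this constant is 0 and \<open>g - h\<close> itself is constant.\<close>

lemma height_sign_determines:
  assumes h: "h \<in> height_functions r" and g: "g \<in> height_functions r"
    and s: "\<And>i. i \<le> 2 * r + 1 \<Longrightarrow> height_sign (2 * r + 1) h i = height_sign (2 * r + 1) g i"
  obtains i where "i \<le> 2 * r + 1" "height_sign (2 * r + 1) h i = 1"
    and "\<And>k. k \<le> 2 * r + 1 \<Longrightarrow> g k - h k = g i - h i"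
proof -
  let ?n = "2 * r + 1"
  have "finite {..?n}" "{..?n} \<noteq> {}" by auto
  then obtain i where "is_arg_min h (\<lambda>i. i \<in> {..?n}) i"
    using ex_is_arg_min_if_finite by blast
  then have i: "i \<le> ?n" and min: "\<And>j. j \<le> ?n \<Longrightarrow> h i \<le> h j"
    by (auto simp: is_arg_min_def not_less)
  have "h (nxt ?n i) = h i + 1" "h (prv ?n i) = h i + 1"
    using min[OF nxt_le[of ?n i]] min[OF prv_le[of ?n i]] height_step[OF h i] by auto
  then have si: "height_sign ?n h i = 1" by (simp add: height_sign_def)
  define D where "D = (\<lambda>k. (g (nxt ?n k) - h (nxt ?n k)) - (g k - h k))"
  have D: "D (nxt ?n k) = D k" if "k \<le> ?n" for k
    using height_sign_neighbours(1)[OF h nxt_le[of ?n k]] height_sign_neighbours(1)[OF g nxt_le[of ?n k]]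
      s[OF nxt_le[of ?n k]] prv_nxt[OF that] by (simp add: D_def)
  have D0: "D k = D 0" if "k \<le> ?n" for k
    using that
  proof (induction k)
    case (Suc k)
    then show ?case using D[of k] by (simp add: nxt_eq)
  qed simp
  have "D i = 0"
    using height_sign_neighbours(3)[OF h i, of "nxt ?n i"] height_sign_neighbours(3)[OF g i, of "nxt ?n i"] s[OF i] si
    by (simp add: D_def adj_def)
  then have D_zero: "D k = 0" if "k \<le> ?n" for k using D0 that i by metis
  have const: "g k - h k = g 0 - h 0" if "k \<le> ?n" for k
    using that
  proof (induction k)
    case (Suc k)
    then show ?case using D_zero[of k] by (simp add: D_def nxt_eq)
  qed simp
  show thesis using that[OF i si] const i by metis
qed

text \<open>The heights are determined up to translation by the signs, and modulo $2L$ by the height of one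
  minimum. So the reductions correspond to the pairs of a value at 0, which has \<open>L\<close> possibilities of
  the right parity modulo $2L$, and a set of \<open>r + 1\<close> ascending steps.\<close>

lemma card_height:
  assumes r: "r \<ge> 1" and n: "n = 2 * r + 1" and L: "L > 1"
    and root: "primitive_root_of_unity (2 * L) e"
  shows "card (thin_family_root.rshape n (height_sign n) (\<lambda>h. h) (2 * L) ` height_functions r)
    = L * ((n + 1) choose (r + 1))"
proof -
  define N where "N = 2 * L"
  have N: "int N = 2 * int L" by (simp add: N_def)
  interpret thin_family_root n "height_functions r" "height_sign n" "\<lambda>h. h" "height_move n" "valley r" N e
    by (intro thin_family_root.intro thin_family_root_axioms.intro thin_family_height r n)
      (use root L in \<open>simp_all add: N_def\<close>)
  define P where "P = {0..<L} \<times> {A. A \<subseteq> {..n} \<and> card A = r + 1}"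
  have cardP: "card P = L * ((n + 1) choose (r + 1))"
    by (simp add: P_def n_subsets card_cartesian_product)
  have in_H: "path_of r x \<in> height_functions r" if "x \<in> P" for x
    using that path_of_in n by (auto simp: P_def)
  have shift: "rshape g = rshape h" if "\<And>i. i \<le> n \<Longrightarrow> g i = h i + int N * q" for g h q
  proof
    fix i
    show "rshape g i = rshape h i"
      using that[of i] that[OF nxt_le[of n i]] that[OF prv_le[of n i]]
      by (simp add: rshape_def height_sign_def)
  qed
  have inj: "inj_on (rshape \<circ> path_of r) P"
  proof (rule inj_onI)
    fix x y assume x: "x \<in> P" and y: "y \<in> P" and *: "(rshape \<circ> path_of r) x = (rshape \<circ> path_of r) y"
    obtain a A where xa: "x = (a, A)" by (cases x)
    obtain b B where yb: "y = (b, B)" by (cases y)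
    define h where "h = path_of r x"
    define g where "g = path_of r y"
    have h: "h \<in> height_functions r" and g: "g \<in> height_functions r"
      using in_H x y by (simp_all add: h_def g_def)
    have eq: "rshape h = rshape g" using * by (simp add: h_def g_def)
    then have s: "height_sign n h i = height_sign n g i" if "i \<le> n" for i
      using st_rshape[OF that] by metis
    obtain i where i: "i \<le> n" "height_sign n h i = 1"
      and const: "\<And>k. k \<le> n \<Longrightarrow> g k - h k = g i - h i"
      using height_sign_determines[OF h g] s unfolding n by metis
    have "single (h i mod int N) 1 = single (g i mod int N) 1"
      using fun_cong[OF eq, of i] i s[OF i(1)] by (simp add: rshape_def)
    then have "single (h i mod int N) 1 (h i mod int N) = single (g i mod int N) 1 (h i mod int N)"
      by (rule fun_cong)
    then have hg: "h i mod int N = g i mod int N" by (simp add: single_def split: if_splits)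
    have AB: "A \<subseteq> {..n}" "card A = r + 1" "B \<subseteq> {..n}" "card B = r + 1" "a < L" "b < L"
      using x y by (simp_all add: P_def xa yb)
    have "k \<in> A \<longleftrightarrow> k \<in> B" if "k \<le> n" for k
    proof -
      have "h (nxt n k) - h k = g (nxt n k) - g k" using const[OF that] const[OF nxt_le[of n k]] by simp
      then show ?thesis
        using path_of_step[of A r k a] path_of_step[of B r k b] AB that n
        by (simp add: h_def g_def xa yb split: if_splits)
    qed
    then have "A = B" using AB by blast
    moreover have "g 0 - h 0 = 2 * (int b - int a)" by (simp add: g_def h_def xa yb path_of_def)
    then have "int N dvd 2 * (int b - int a)"
      using const[of 0] hg by (metis mod_eq_dvd_iff zero_le)
    then have "int L dvd int b - int a" unfolding N dvd_mult_cancel_left by simp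
    then have "int b mod int L = int a mod int L" by (simp add: mod_eq_dvd_iff)
    then have "a = b" using AB by simp
    ultimately show "x = y" by (simp add: xa yb)
  qed
  have "rshape h \<in> (rshape \<circ> path_of r) ` P" if h: "h \<in> height_functions r" for h
  proof -
    define A where "A = {k. k \<le> n \<and> h (nxt n k) - h k = 1}"
    note A = height_up_steps[OF h, folded n, folded A_def]
    have "even (h 0 - int (r + 1))" using h by (simp add: height_functions_def)
    then obtain c where c: "h 0 = int (r + 1) + 2 * c" by (metis evenE add_diff_cancel_left' diff_add_cancel add.commute)
    define a where "a = nat (c mod int L)"
    have Lp: "int L > 0" using L by simp
    have ia: "int a = c mod int L" using Lp by (simp add: a_def)
    then have aL: "a < L" using Lp pos_mod_bound[of "int L" c] by linarith
    have "c = int a + int L * (c div int L)" by (simp add: ia)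
    then have "h i = path_of r (a, A) i + int N * (c div int L)" if "i \<le> n" for i
      using A(3)[OF that] c that n unfolding N path_of_def by (simp add: algebra_simps)
    then have "rshape h = (rshape \<circ> path_of r) (a, A)" using shift by simp
    moreover have "(a, A) \<in> P" using aL A by (simp add: P_def)
    ultimately show ?thesis by blast
  qed
  then have "rshape ` height_functions r = (rshape \<circ> path_of r) ` P"
    using in_H by (auto simp: image_iff)
  then have "card (rshape ` height_functions r) = L * ((n + 1) choose (r + 1))"
    using card_image[OF inj] cardP by simp
  then show ?thesis by (simp only: N_def)
qed

theorem theorem4p18:
  fixes n r l p L :: nat and s :: "nat \<Rightarrow> int" and e :: complex
  assumes "n = 2 * r + 1" and "r \<ge> 1"
    and "l \<in> {1, r + 1, n}"
    and "l \<in> {1, n} \<Longrightarrow> p = n + 1" and "l = r + 1 \<Longrightarrow> p = 2"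
    and "L \<ge> 1" and "p \<noteq> 2 \<or> L > 1"
    and "primitive_root_of_unity (p * L) e"
    and "parity_fun n s" and "start_monomial n l \<in> monomial_group n s"
  shows "\<exists>(V :: (rmonomial \<Rightarrow> complex) set) act.
    toroidal_module fscale n e V act \<and>
    toroidal_module.irreducible_module fscale n V act \<and>
    vector_space.dim fscale V = L * ((n + 1) choose l) \<and>
    has_qcharacter fscale n e (p * L) V act (crystal_E_red n s l (p * L)) \<and>
    (\<exists>v. indexed_basis fscale V (crystal_E_red n s l (p * L)) v \<and>
      (\<forall>m \<in> crystal_E n s l. \<forall>i\<le>n.
        (\<forall>a::int. act (X Plus i a) (v (reduce (p * L) m))
            = fscale (e powi (a * (p_ind m i - 1))) (vec_at (p * L) v (e_op n i m))) \<and>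
        (\<forall>a::int. act (X Minus i a) (v (reduce (p * L) m))
            = fscale (e powi (a * (q_ind m i + 1))) (vec_at (p * L) v (f_op n i m))) \<and>
        (\<forall>\<sigma>. \<forall>t::int. t > 0 \<longrightarrow>
            phi_gen fscale e act \<sigma> i (sg \<sigma> * t) (v (reduce (p * L) m))
            = fscale (of_int (sg \<sigma>) * (e - inverse e) *
                 (of_int (phi m i) * e powi (sg \<sigma> * t * (q_ind m i + 1))
                  - of_int (eps m i) * e powi (sg \<sigma> * t * (p_ind m i - 1))))
                (v (reduce (p * L) m))) \<and>
        (\<forall>\<sigma>. act (K \<sigma> i) (v (reduce (p * L) m))
            = fscale (e powi (sg \<sigma> * (phi m i - eps m i))) (v (reduce (p * L) m)))))"
proof -
  have n2: "n \<ge> 2" using assms(1,2) by simp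
  consider "l = r + 1" | "l = 1 \<or> l = n" "l \<noteq> r + 1" using assms(3) by blast
  then show ?thesis
  proof cases
    case 1
    then have p: "p = 2" and L: "L > 1" using assms by simp_all
    have root: "primitive_root_of_unity (2 * L) e" using assms(8) p by simp
    interpret thin_family_root n "height_functions r" "height_sign n" "\<lambda>h. h" "height_move n" "valley r" "2 * L" e
      by (intro thin_family_root.intro thin_family_root_axioms.intro thin_family_height assms root)
        (use L in simp)
    have start: "expo (start_monomial n l) = shape (valley r)"
      using start_monomial_height[OF assms(2,1)] 1 by simp
    show ?thesis
      using module_of_subcrystal[OF start assms(10)] card_height[OF assms(2,1) L root]
      unfolding crystal_E_red_def crystal_E_def p 1 by simp
  next
    case 2
    then have p: "p = n + 1" using assms(4) by simp
    have root: "primitive_root_of_unity ((n + 1) * L) e" using assms(8) p by simp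
    define d :: int where "d = (if l = 1 then 1 else -1)"
    have d: "d \<in> {1, -1}" by (simp add: d_def)
    have l: "l = (if d = 1 then 1 else n)" using 2 by (auto simp: d_def)
    have N3: "(n + 1) * L \<ge> 3" using n2 assms(6) mult_le_mono[of 3 "n + 1" 1 L] by simp
    interpret thin_family_root n UNIV "line_sign n d" "line_height n d" "line_move n d" 1 "(n + 1) * L" e
      by (intro thin_family_root.intro thin_family_root_axioms.intro thin_family_line d n2 root N3)
    have binom: "(n + 1) choose l = n + 1"
      using 2 binomial_symmetric[of n "n + 1"] by auto
    have card: "card (rshape ` UNIV) = L * ((n + 1) choose l)"
      unfolding binom using card_line[OF d n2 assms(6) root] by (simp only: mult.commute)
    show ?thesis
      using module_of_subcrystal[OF start_monomial_line[OF d n2 l] assms(10)]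
      unfolding card crystal_E_red_def crystal_E_def p .
  qed
qed

end
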